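(* Let $\Omega\subset\mathbb{R}^n$ be a convex body and let $c\in[0,|\Omega|]$. Let $\mathcal{K}_c$ be the class of convex sets $\omega\subset\Omega$ with $|\omega|=c$, endowed with the Hausdorff distance $d^H$. For $p\in[1,+\infty)$ and $\omega\in\mathcal{K}_c$ set $$\mathcal{J}_p(\omega)=\left(\int_{\mathbb{S}^{n-1}}|h_\Omega-h_\omega|^p\,d\mathcal{H}^{n-1}\right)^{1/p},\qquad \mathcal{J}_\infty(\omega)=d^H(\omega,\Omega)=\max_{\theta\in\mathbb{S}^{n-1}}|h_\Omega(\theta)-h_\omega(\theta)|,$$ and $\sigma_p=\inf\{\mathcal{J}_p(\omega)\ |\ \omega\in\mathcal{K}_c\}$, $\sigma_\infty=\inf\{d^H(\omega,\Omega)\ |\ \omega\in\mathcal{K}_c\}$. Then: (i) For every $p\in[1,+\infty)$, the problem $\inf\{\mathcal{J}_p(\omega)\ |\ \omega\in\mathcal{K}_c\}$ admits solutions, i.e. the infimum $\sigma_p$ is attained. (ii) The functionals $\mathcal{J}_p$ $\Gamma$-converge to $\mathcal{J}_\infty$ on $(\mathcal{K}_c,d^H)$ as $p\to+\infty$. Therefore $\lim_{p\to+\infty}\sigma_p=\sigma_\infty$, and every accumulation point, with respect to $d^H$ and as $p\to+\infty$, of solutions of the problems $\inf\{\mathcal{J}_p(\omega)\ |\ \omega\in\mathcal{K}_c\}$ is a solution of the problem $\min\{d^H(\omega,\Omega)\ |\ \omega\in\mathcal{K}_c\}$.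
   Context: A convex body is a compact convex set; the container $\Omega$ has non-empty interior. The competitors $\omega$ are non-empty compact convex sets (possibly with empty interior when $c=0$). $|\cdot|$ denotes Lebesgue measure in $\mathbb{R}^n$, $\mathbb{S}^{n-1}$ the unit sphere, and $\mathcal{H}^{n-1}$ the $(n-1)$-dimensional Hausdorff measure on it. The support function of a convex set $K$ is $h_K:\mathbb{S}^{n-1}\to\mathbb{R}$, $h_K(\theta)=\sup\{\langle\theta,y\rangle\ |\ y\in K\}$. The Hausdorff distance is $d^H(X,Y)=\max\{\sup_{x\in X}\inf_{y\in Y}\|x-y\|,\ \sup_{y\in Y}\inf_{x\in X}\|x-y\|\}$. $\Gamma$-convergence of $\mathcal{J}_p$ to $\mathcal{J}_\infty$ on the metric space $(\mathcal{K}_c,d^H)$ as $p\to+\infty$ means that for every sequence $p_k\to+\infty$: (a) for every $\omega\in\mathcal{K}_c$ and every sequence $(\omega_k)$ in $\mathcal{K}_c$ converging to $\omega$, $\mathcal{J}_\infty(\omega)\le\liminf_k\mathcal{J}_{p_k}(\omega_k)$; (b) for every $\omega\in\mathcal{K}_c$ there is a sequence $(\omega_k)$ in $\mathcal{K}_c$ converging to $\omega$ with $\mathcal{J}_\infty(\omega)\ge\limsup_k\mathcal{J}_{p_k}(\omega_k)$. An accumulation point of solutions as $p\to+\infty$ is a $d^H$-limit of a sequence $(\omega_{p_k})$ with $p_k\to+\infty$ and $\omega_{p_k}$ a solution of the problem with $p=p_k$. *)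

theory Defs
  imports "HOL-Analysis.Analysis"
begin

section \<open>Hausdorff measure\<close>

text \<open>
  The empty set is treated separately because \<open>0 ^ 0 = 1\<close>: for \<open>s = 0\<close> non-empty sets must
  have weight 1 and the empty set weight 0.
\<close>

definition hausdorff_weight :: "nat \<Rightarrow> 'a::metric_space set \<Rightarrow> ennreal" where
  "hausdorff_weight s U =
    (if U = {} then 0 else ennreal (unit_ball_vol (real s) * (diameter U / 2) ^ s))"

text \<open>
  Boundedness of the covering sets has to be required explicitly, since
  \<^const>\<open>diameter\<close> carries no information about unbounded sets.
\<close>

definition hausdorff_pre_measure :: "nat \<Rightarrow> real \<Rightarrow> 'a::metric_space set \<Rightarrow> ennreal" where
  "hausdorff_pre_measure s \<delta> A =
    (INF C\<in>{C :: nat \<Rightarrow> 'a set. A \<subseteq> (\<Union>i. C i) \<and> (\<forall>i. bounded (C i) \<and> diameter (C i) \<le> \<delta>)}.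
      \<Sum>i. hausdorff_weight s (C i))"

definition hausdorff_outer_measure :: "nat \<Rightarrow> 'a::metric_space set \<Rightarrow> ennreal" where
  "hausdorff_outer_measure s A = (SUP \<delta>\<in>{0<..}. hausdorff_pre_measure s \<delta> A)"

definition hausdorff_measure :: "nat \<Rightarrow> 'a::metric_space measure" where
  "hausdorff_measure s = measure_of UNIV (sets borel) (hausdorff_outer_measure s)"

text \<open>
  \<^const>\<open>measure_of\<close> yields the null measure when its argument is not countably additive.
  The following development excludes this: \<open>emeasure_hausdorff_measure\<close> below
  identifies \<open>hausdorff_measure s\<close> with the outer measure on all Borel sets.
\<close>

lemma hausdorff_weight_empty [simp]: "hausdorff_weight s {} = 0"
  by (simp add: hausdorff_weight_def)

lemma hausdorff_pre_measure_le:
  assumes "A \<subseteq> (\<Union>i. C i)" "\<And>i. bounded (C i)" "\<And>i. diameter (C i) \<le> \<delta>"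
  shows "hausdorff_pre_measure s \<delta> A \<le> (\<Sum>i. hausdorff_weight s (C i))"
  unfolding hausdorff_pre_measure_def using assms by (intro INF_lower) auto

lemma hausdorff_pre_measure_mono:
  "A \<subseteq> B \<Longrightarrow> hausdorff_pre_measure s \<delta> A \<le> hausdorff_pre_measure s \<delta> B"
  unfolding hausdorff_pre_measure_def by (intro INF_superset_mono) auto

lemma hausdorff_pre_measure_antimono:
  "\<delta> \<le> \<epsilon> \<Longrightarrow> hausdorff_pre_measure s \<epsilon> A \<le> hausdorff_pre_measure s \<delta> A"
  unfolding hausdorff_pre_measure_def by (rule INF_superset_mono) (blast intro: order_trans, simp)

lemma hausdorff_pre_measure_empty:
  assumes "0 < \<delta>"
  shows "hausdorff_pre_measure s \<delta> {} = 0"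
  using hausdorff_pre_measure_le[of "{}" "\<lambda>_. {}" \<delta> s] assms by simp

lemma hausdorff_pre_measure_UN_le:
  fixes A :: "nat \<Rightarrow> 'a::metric_space set"
  shows "hausdorff_pre_measure s \<delta> (\<Union>i. A i) \<le> (\<Sum>i. hausdorff_pre_measure s \<delta> (A i))"
proof (rule ennreal_le_epsilon)
  fix e :: real
  assume "0 < e" "(\<Sum>i. hausdorff_pre_measure s \<delta> (A i)) < top"
  then have *: "hausdorff_pre_measure s \<delta> (A n)
      < hausdorff_pre_measure s \<delta> (A n) + e * (1/2) ^ Suc n" for n
    by (auto simp add: less_top dest!: ennreal_suminf_lessD)
  have "\<exists>C :: nat \<Rightarrow> 'a set. A n \<subseteq> (\<Union>i. C i) \<and> (\<forall>i. bounded (C i) \<and> diameter (C i) \<le> \<delta>) \<and>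
      (\<Sum>i. hausdorff_weight s (C i)) \<le> hausdorff_pre_measure s \<delta> (A n) + e * (1/2) ^ Suc n" for n
    using *[of n] by (subst (asm) hausdorff_pre_measure_def) (auto simp: INF_less_iff intro: less_imp_le)
  then obtain B :: "nat \<Rightarrow> nat \<Rightarrow> 'a set" where
    B: "\<And>n. A n \<subseteq> (\<Union>i. B n i)" "\<And>n i. bounded (B n i)" "\<And>n i. diameter (B n i) \<le> \<delta>"
       "\<And>n. (\<Sum>i. hausdorff_weight s (B n i))
          \<le> hausdorff_pre_measure s \<delta> (A n) + e * (1/2) ^ Suc n"
    by metis
  define C where "C = case_prod B o prod_decode"
  have "(\<Union>i. A i) \<subseteq> (\<Union>i. C i)"
    using B(1) by (auto simp add: C_def subset_eq) (metis prod.case prod_encode_inverse)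
  then have "hausdorff_pre_measure s \<delta> (\<Union>i. A i) \<le> (\<Sum>i. hausdorff_weight s (C i))"
    by (intro hausdorff_pre_measure_le) (auto simp: C_def B split_def)
  also have "\<dots> = (\<Sum>n. \<Sum>i. hausdorff_weight s (B n i))"
    unfolding C_def comp_def by (intro suminf_ennreal_2dimen) auto
  also have "\<dots> \<le> (\<Sum>n. hausdorff_pre_measure s \<delta> (A n) + e * (1/2) ^ Suc n)"
    by (intro suminf_le allI B) auto
  also have "\<dots> = (\<Sum>n. hausdorff_pre_measure s \<delta> (A n)) + (\<Sum>n. ennreal e * ennreal ((1/2) ^ Suc n))"
    using \<open>0 < e\<close> by (subst suminf_add[symmetric])
      (auto simp del: ennreal_suminf_cmult simp add: ennreal_mult[symmetric])
  also have "\<dots> = (\<Sum>n. hausdorff_pre_measure s \<delta> (A n)) + e"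
    unfolding ennreal_suminf_cmult
    by (subst suminf_ennreal_eq[OF zero_le_power power_half_series]) auto
  finally show "hausdorff_pre_measure s \<delta> (\<Union>i. A i)
      \<le> (\<Sum>n. hausdorff_pre_measure s \<delta> (A n)) + e" .
qed

lemma hausdorff_pre_measure_le_outer:
  "0 < \<delta> \<Longrightarrow> hausdorff_pre_measure s \<delta> A \<le> hausdorff_outer_measure s A"
  unfolding hausdorff_outer_measure_def by (intro SUP_upper) auto

lemma hausdorff_outer_measure_empty [simp]: "hausdorff_outer_measure s {} = 0"
  by (simp add: hausdorff_outer_measure_def hausdorff_pre_measure_empty)

lemma hausdorff_outer_measure_mono:
  "A \<subseteq> B \<Longrightarrow> hausdorff_outer_measure s A \<le> hausdorff_outer_measure s B"
  unfolding hausdorff_outer_measure_def by (intro SUP_mono') (rule hausdorff_pre_measure_mono)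

lemma hausdorff_outer_measure_UN_le:
  "hausdorff_outer_measure s (\<Union>i::nat. A i) \<le> (\<Sum>i. hausdorff_outer_measure s (A i))"
proof -
  have "hausdorff_pre_measure s \<delta> (\<Union>i. A i) \<le> (\<Sum>i. hausdorff_outer_measure s (A i))"
    if "0 < \<delta>" for \<delta>
    by (rule order_trans[OF hausdorff_pre_measure_UN_le])
       (use that in \<open>auto intro!: suminf_le hausdorff_pre_measure_le_outer\<close>)
  then show ?thesis
    unfolding hausdorff_outer_measure_def[of s "\<Union>i. A i"] by (intro SUP_least) auto
qed

lemma outer_measure_space_hausdorff:
  "outer_measure_space (Pow UNIV) (hausdorff_outer_measure s)"
  by (auto simp: outer_measure_space_def positive_def increasing_def countably_subadditive_def
      intro: hausdorff_outer_measure_mono hausdorff_outer_measure_UN_le)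

lemma hausdorff_outer_measure_Un_le:
  "hausdorff_outer_measure s (A \<union> B) \<le> hausdorff_outer_measure s A + hausdorff_outer_measure s B"
proof -
  interpret sigma_algebra UNIV "Pow UNIV"
    by (rule sigma_algebra_Pow)
  have "subadditive (Pow UNIV) (hausdorff_outer_measure s :: 'a set \<Rightarrow> _)"
    using outer_measure_space_hausdorff
    by (intro countably_subadditive_subadditive) (auto simp: outer_measure_space_def)
  moreover have "hausdorff_outer_measure s (A \<union> (B - A)) = hausdorff_outer_measure s (A \<union> B)"
    by simp
  ultimately have "hausdorff_outer_measure s (A \<union> B)
      \<le> hausdorff_outer_measure s A + hausdorff_outer_measure s (B - A)"
    unfolding subadditive_def by (metis Diff_disjoint Pow_UNIV UNIV_I)
  also have "\<dots> \<le> hausdorff_outer_measure s A + hausdorff_outer_measure s B"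
    by (intro add_left_mono hausdorff_outer_measure_mono) auto
  finally show ?thesis .
qed

lemma hausdorff_pre_measure_separated:
  fixes A B :: "'a::metric_space set"
  assumes sep: "\<And>x y. x \<in> A \<Longrightarrow> y \<in> B \<Longrightarrow> \<delta> < dist x y"
    and "0 < \<delta>"
  shows "hausdorff_pre_measure s \<delta> A + hausdorff_pre_measure s \<delta> B \<le> hausdorff_pre_measure s \<delta> (A \<union> B)"
  unfolding hausdorff_pre_measure_def[of s \<delta> "A \<union> B"]
proof (rule INF_greatest, clarify)
  fix C :: "nat \<Rightarrow> 'a set"
  assume cov: "A \<union> B \<subseteq> (\<Union>i. C i)" and C: "\<forall>i. bounded (C i) \<and> diameter (C i) \<le> \<delta>"
  define D where "D X i = (if C i \<inter> X = {} then {} else C i)" for X i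
  have D: "hausdorff_pre_measure s \<delta> X \<le> (\<Sum>i. hausdorff_weight s (D X i))" if X: "X \<subseteq> A \<union> B" for X
  proof (rule hausdorff_pre_measure_le)
    show "X \<subseteq> (\<Union>i. D X i)"
    proof
      fix x assume "x \<in> X"
      moreover obtain i where "x \<in> C i"
        using \<open>x \<in> X\<close> X cov by blast
      ultimately have "x \<in> D X i"
        by (auto simp: D_def)
      then show "x \<in> (\<Union>i. D X i)" by blast
    qed
  qed (use C \<open>0 < \<delta>\<close> in \<open>auto simp: D_def\<close>)
  have disj: "C i \<inter> A = {} \<or> C i \<inter> B = {}" for i
  proof (rule ccontr)
    assume "\<not> ?thesis"
    then obtain x y where xy: "x \<in> C i" "x \<in> A" "y \<in> C i" "y \<in> B"
      by blast
    have "dist x y \<le> \<delta>"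
      using diameter_bounded_bound[of "C i" x y] xy C by (meson order_trans)
    then show False
      using sep[of x y] xy by simp
  qed
  have "hausdorff_pre_measure s \<delta> A + hausdorff_pre_measure s \<delta> B
      \<le> (\<Sum>i. hausdorff_weight s (D A i)) + (\<Sum>i. hausdorff_weight s (D B i))"
    by (intro add_mono D) auto
  also have "\<dots> = (\<Sum>i. hausdorff_weight s (D A i) + hausdorff_weight s (D B i))"
    by (intro suminf_add) auto
  also have "\<dots> \<le> (\<Sum>i. hausdorff_weight s (C i))"
    using disj by (intro suminf_le) (auto simp: D_def)
  finally show "hausdorff_pre_measure s \<delta> A + hausdorff_pre_measure s \<delta> B
      \<le> (\<Sum>i. hausdorff_weight s (C i))" .
qed

lemma hausdorff_outer_measure_separated:
  fixes A B :: "'a::metric_space set"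
  assumes sep: "\<And>x y. x \<in> A \<Longrightarrow> y \<in> B \<Longrightarrow> e \<le> dist x y"
    and "0 < e"
  shows "hausdorff_outer_measure s A + hausdorff_outer_measure s B \<le> hausdorff_outer_measure s (A \<union> B)"
proof -
  have *: "hausdorff_pre_measure s \<delta> A + hausdorff_pre_measure s \<epsilon> B \<le> hausdorff_outer_measure s (A \<union> B)"
    if "0 < \<delta>" "0 < \<epsilon>" for \<delta> \<epsilon>
  proof -
    define r where "r = min (min \<delta> \<epsilon>) (e / 2)"
    have r: "0 < r" "r \<le> \<delta>" "r \<le> \<epsilon>" "r < e"
      using that \<open>0 < e\<close> by (auto simp: r_def)
    have "hausdorff_pre_measure s \<delta> A + hausdorff_pre_measure s \<epsilon> B
        \<le> hausdorff_pre_measure s r A + hausdorff_pre_measure s r B"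
      using r by (intro add_mono hausdorff_pre_measure_antimono)
    also have "\<dots> \<le> hausdorff_pre_measure s r (A \<union> B)"
      using r by (intro hausdorff_pre_measure_separated) (auto dest: sep intro: less_le_trans)
    also have "\<dots> \<le> hausdorff_outer_measure s (A \<union> B)"
      using r by (intro hausdorff_pre_measure_le_outer)
    finally show ?thesis .
  qed
  have ne: "{0::real<..} \<noteq> {}"
    by (metis greaterThan_non_empty)
  have **: "hausdorff_pre_measure s \<delta> A + hausdorff_outer_measure s B \<le> hausdorff_outer_measure s (A \<union> B)"
    if "0 < \<delta>" for \<delta>
    unfolding hausdorff_outer_measure_def[of s B]
    by (subst ennreal_SUP_add_right[OF ne]) (use * that in \<open>auto intro!: SUP_least\<close>)
  show ?thesis
    unfolding hausdorff_outer_measure_def[of s A]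
    by (subst ennreal_SUP_add_left[OF ne, symmetric]) (use ** in \<open>auto intro!: SUP_least\<close>)
qed

lemma hausdorff_outer_measure_separated_sum:
  fixes R :: "nat \<Rightarrow> 'a::metric_space set"
  assumes sep: "\<And>i j. i < j \<Longrightarrow> \<exists>e>0. \<forall>x\<in>R i. \<forall>y\<in>R j. e \<le> dist x y"
  shows "(\<Sum>i<n. hausdorff_outer_measure s (R i)) \<le> hausdorff_outer_measure s (\<Union>i<n. R i)"
proof (induction n)
  case (Suc n)
  have "\<forall>i. \<exists>e. i < n \<longrightarrow> 0 < e \<and> (\<forall>x\<in>R i. \<forall>y\<in>R n. e \<le> dist x y)"
    using sep[of _ n] by blast
  then obtain e where e: "\<And>i. i < n \<Longrightarrow> 0 < e i"
      "\<And>i x y. i < n \<Longrightarrow> x \<in> R i \<Longrightarrow> y \<in> R n \<Longrightarrow> e i \<le> dist x y"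
    using choice[of "\<lambda>i e. i < n \<longrightarrow> 0 < e \<and> (\<forall>x\<in>R i. \<forall>y\<in>R n. e \<le> dist x y)"] by blast
  define d where "d = Min (insert 1 (e ` {..<n}))"
  have d: "0 < d" "\<And>i. i < n \<Longrightarrow> d \<le> e i"
    using e(1) by (auto simp: d_def)
  have "(\<Sum>i<Suc n. hausdorff_outer_measure s (R i))
      \<le> hausdorff_outer_measure s (\<Union>i<n. R i) + hausdorff_outer_measure s (R n)"
    using Suc by (simp add: add_right_mono)
  also have "\<dots> \<le> hausdorff_outer_measure s ((\<Union>i<n. R i) \<union> R n)"
    by (rule hausdorff_outer_measure_separated[OF _ d(1)]) (use d(2) e(2) in force)
  also have "(\<Union>i<n. R i) \<union> R n = (\<Union>i<Suc n. R i)"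
    by (auto simp: less_Suc_eq)
  finally show ?case .
qed simp

lemma hausdorff_caratheodory_closed:
  fixes F T :: "'a::metric_space set"
  assumes "closed F"
  shows "hausdorff_outer_measure s (T \<inter> F) + hausdorff_outer_measure s (T - F) \<le> hausdorff_outer_measure s T"
proof (cases "F = {} \<or> hausdorff_outer_measure s T = top")
  case True
  then show ?thesis by auto
next
  case False
  let ?m = "hausdorff_outer_measure s"
  define G where "G n = {x\<in>T. 1 / real (Suc n) \<le> infdist x F}" for n
  define R where "R n = {x\<in>T. 1 / real (Suc (Suc n)) \<le> infdist x F \<and> infdist x F < 1 / real (Suc n)}" for n
  have fin: "?m T < top" using False by (simp add: less_top)
  have G: "?m (T \<inter> F) + ?m (G n) \<le> ?m T" for n
  proof -
    have "1 / real (Suc n) \<le> dist x y" if "x \<in> T \<inter> F" "y \<in> G n" for x y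
      using that infdist_le[of x F y] by (simp add: G_def dist_commute)
    then have "?m (T \<inter> F) + ?m (G n) \<le> ?m ((T \<inter> F) \<union> G n)"
      by (rule hausdorff_outer_measure_separated) auto
    also have "\<dots> \<le> ?m T"
      by (intro hausdorff_outer_measure_mono) (auto simp: G_def)
    finally show ?thesis .
  qed
  have Rsep: "\<exists>e>0. \<forall>x\<in>R i. \<forall>y\<in>R j. e \<le> dist x y" if "Suc i < j" for i j
  proof (intro exI conjI ballI)
    have "1 / real (Suc j) < 1 / real (Suc (Suc i))"
      using that by (intro divide_strict_left_mono) auto
    then show "0 < 1 / real (Suc (Suc i)) - 1 / real (Suc j)"
      by simp
    fix x y assume "x \<in> R i" "y \<in> R j"
    moreover have "1 / real (Suc j) \<le> 1 / real (Suc (Suc i))"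
      using that by (intro divide_left_mono) auto
    moreover have "infdist x F \<le> infdist y F + dist x y"
      by (rule infdist_triangle)
    ultimately show "1 / real (Suc (Suc i)) - 1 / real (Suc j) \<le> dist x y"
      by (auto simp: R_def)
  qed
  have half: "(\<Sum>i. ?m (R (2 * i + b))) \<le> ?m T" for b
  proof (rule suminf_le_const)
    fix n
    have "(\<Sum>i<n. ?m (R (2 * i + b))) \<le> ?m (\<Union>i<n. R (2 * i + b))"
      by (rule hausdorff_outer_measure_separated_sum) (rule Rsep, simp)
    also have "\<dots> \<le> ?m T"
      by (intro hausdorff_outer_measure_mono) (auto simp: R_def)
    finally show "(\<Sum>i<n. ?m (R (2 * i + b))) \<le> ?m T" .
  qed simp
  have "(\<Sum>i. ?m (R i)) \<le> ?m T + ?m T"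
  proof (rule suminf_le_const)
    fix n
    have "(\<Sum>i<n. ?m (R i)) \<le> (\<Sum>i<2 * n. ?m (R i))"
      by (rule sum_mono2) auto
    also have "\<dots> = (\<Sum>i<n. ?m (R (2 * i + 0))) + (\<Sum>i<n. ?m (R (2 * i + 1)))"
      by (induction n) (auto simp: ac_simps)
    also have "\<dots> \<le> ?m T + ?m T"
      by (intro add_mono order_trans[OF sum_le_suminf half]) auto
    finally show "(\<Sum>i<n. ?m (R i)) \<le> ?m T + ?m T" .
  qed simp
  then have Rfin: "(\<Sum>i. ?m (R i)) \<noteq> top"
    using fin by (auto simp: top_unique)
  have tail: "?m (T - F) \<le> ?m (G n) + (\<Sum>i. ?m (R (i + n)))" for n
  proof -
    have "T - F \<subseteq> G n \<union> (\<Union>i. R (i + n))"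
    proof
      fix x assume x: "x \<in> T - F"
      then have pos: "0 < infdist x F"
        using False \<open>closed F\<close> in_closed_iff_infdist_zero[of F x] infdist_nonneg[of x F]
        by (auto simp: less_le)
      then obtain k where k: "1 / real (Suc k) \<le> infdist x F"
        using reals_Archimedean[of "infdist x F"] by (auto simp: inverse_eq_divide intro: less_imp_le)
      define m where "m = (LEAST k. 1 / real (Suc k) \<le> infdist x F)"
      have m: "1 / real (Suc m) \<le> infdist x F"
        unfolding m_def by (rule LeastI[of _ k]) (rule k)
      show "x \<in> G n \<union> (\<Union>i. R (i + n))"
      proof (cases "m \<le> n")
        case True
        then have "1 / real (Suc n) \<le> 1 / real (Suc m)"
          by (intro divide_left_mono) auto
        then show ?thesis
          using m x by (auto simp: G_def)
      next
        case False
        then obtain i where i: "m = Suc (i + n)"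
          by (metis add.commute less_imp_Suc_add not_le)
        have "\<not> 1 / real (Suc (i + n)) \<le> infdist x F"
          using not_less_Least[of "i + n" "\<lambda>k. 1 / real (Suc k) \<le> infdist x F"] i
          by (auto simp: m_def)
        then have "x \<in> R (i + n)"
          using m x i by (auto simp: R_def)
        then show ?thesis by blast
      qed
    qed
    then have "?m (T - F) \<le> ?m (G n \<union> (\<Union>i. R (i + n)))"
      by (rule hausdorff_outer_measure_mono)
    also have "\<dots> \<le> ?m (G n) + ?m (\<Union>i. R (i + n))"
      by (rule hausdorff_outer_measure_Un_le)
    also have "\<dots> \<le> ?m (G n) + (\<Sum>i. ?m (R (i + n)))"
      by (intro add_left_mono hausdorff_outer_measure_UN_le)
    finally show ?thesis .
  qed
  show ?thesis
  proof (rule ennreal_le_epsilon)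
    fix e :: real assume "0 < e"
    define r where "r i = enn2real (?m (R i))" for i
    have "?m (R i) < top" for i
      using ennreal_suminf_lessD[of "\<lambda>i. ?m (R i)" top i] Rfin by (simp add: less_top)
    then have r: "?m (R i) = ennreal (r i)" "0 \<le> r i" for i
      by (simp_all add: r_def)
    have sr: "summable r"
      using Rfin r by (intro summable_suminf_not_top) auto
    then have "(\<lambda>n. \<Sum>i. r (i + n)) \<longlonglongrightarrow> 0"
      by (rule suminf_exist_split2)
    then obtain n where n: "(\<Sum>i. r (i + n)) < e"
      using \<open>0 < e\<close> eventually_happens'[OF sequentially_bot order_tendstoD(2)] by blast
    have "(\<Sum>i. ?m (R (i + n))) = ennreal (\<Sum>i. r (i + n))"
      using r sr by (simp add: suminf_ennreal2 summable_iff_shift)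
    also have "\<dots> \<le> ennreal e"
      using n by (intro ennreal_leI) auto
    finally have "?m (T \<inter> F) + ?m (T - F) \<le> ?m (T \<inter> F) + (?m (G n) + ennreal e)"
      using tail[of n] by (intro add_left_mono) (meson add_left_mono order_trans)
    also have "\<dots> \<le> ?m T + ennreal e"
      using G[of n] by (simp add: add.assoc[symmetric] add_right_mono)
    finally show "?m (T \<inter> F) + ?m (T - F) \<le> ?m T + ennreal e" .
  qed
qed

lemma measure_space_hausdorff:
  "measure_space (UNIV :: 'a::metric_space set) (sets borel) (hausdorff_outer_measure s)"
proof -
  interpret P: sigma_algebra UNIV "Pow (UNIV :: 'a set)"
    by (rule sigma_algebra_Pow)
  let ?L = "lambda_system UNIV (Pow (UNIV :: 'a set)) (hausdorff_outer_measure s)"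
  have L: "measure_space UNIV ?L (hausdorff_outer_measure s)"
    by (rule P.caratheodory_lemma[OF outer_measure_space_hausdorff])
  then interpret L: sigma_algebra UNIV ?L
    by (simp add: measure_space_def)
  have "F \<in> ?L" if "closed F" for F
  proof -
    have "hausdorff_outer_measure s (T \<inter> F) + hausdorff_outer_measure s (T - F) = hausdorff_outer_measure s T" for T
    proof (rule antisym)
      show "hausdorff_outer_measure s T \<le> hausdorff_outer_measure s (T \<inter> F) + hausdorff_outer_measure s (T - F)"
        using hausdorff_outer_measure_Un_le[of s "T \<inter> F" "T - F"] by (simp add: Int_Diff_Un)
    qed (rule hausdorff_caratheodory_closed[OF that])
    then show ?thesis
      by (subst P.lambda_system_eq) auto
  qed
  then have "sigma_sets UNIV (Collect closed) \<subseteq> ?L"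
    by (intro L.sigma_sets_subset) auto
  then have "sets borel \<subseteq> ?L"
    by (simp add: borel_eq_closed)
  moreover have "sigma_algebra UNIV (sets (borel :: 'a measure))"
    using sets.sigma_algebra_axioms[of "borel :: 'a measure"] by simp
  ultimately show ?thesis
    using L by (auto simp: measure_space_def positive_def countably_additive_def)
qed

lemma space_hausdorff_measure [simp]: "space (hausdorff_measure s) = UNIV"
  by (simp add: hausdorff_measure_def space_measure_of_conv)

lemma sets_hausdorff_measure [simp, measurable_cong]: "sets (hausdorff_measure s) = sets borel"
  using sets.sigma_sets_eq[of borel] by (simp add: hausdorff_measure_def sets_measure_of_conv)

lemma emeasure_hausdorff_measure:
  "A \<in> sets borel \<Longrightarrow> emeasure (hausdorff_measure s) A = hausdorff_outer_measure s A"
  using measure_space_hausdorff[of s] unfolding hausdorff_measure_def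
  by (intro emeasure_measure_of_sigma) (auto simp: measure_space_def)


section \<open>Support functions and the Hausdorff distance\<close>

definition support_fun :: "'a::real_inner set \<Rightarrow> 'a \<Rightarrow> real" where
  "support_fun K \<theta> = (SUP y\<in>K. \<theta> \<bullet> y)"

text \<open>Meaningful for non-empty bounded sets, on which all infima and suprema are finite.\<close>

definition hausdorff_dist :: "'a::metric_space set \<Rightarrow> 'a set \<Rightarrow> real" where
  "hausdorff_dist X Y = max (SUP x\<in>X. infdist x Y) (SUP y\<in>Y. infdist y X)"


section \<open>Minimisers and \<open>\<Gamma>\<close>-convergence\<close>

text \<open>
  A real infimum is only meaningful for non-empty sets and functionals bounded below;
  all functionals below are non-negative.
\<close>

definition inf_value :: "'x set \<Rightarrow> ('x \<Rightarrow> real) \<Rightarrow> real" where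
  "inf_value X F = (INF x\<in>X. F x)"

definition solves_min :: "'x set \<Rightarrow> ('x \<Rightarrow> real) \<Rightarrow> 'x \<Rightarrow> bool" where
  "solves_min X F x \<longleftrightarrow> x \<in> X \<and> F x = inf_value X F"

text \<open>
  \<open>\<Gamma>\<close>-convergence of \<open>J p\<close> to \<open>Jinf\<close> on the set \<open>X\<close> with distance \<open>d\<close> as \<open>p \<rightarrow> \<infinity>\<close>,
  the parameter ranging over \<open>[1, \<infinity>)\<close>.
\<close>

definition Gamma_converges ::
  "'x set \<Rightarrow> ('x \<Rightarrow> 'x \<Rightarrow> real) \<Rightarrow> (real \<Rightarrow> 'x \<Rightarrow> real) \<Rightarrow> ('x \<Rightarrow> real) \<Rightarrow> bool" where
  "Gamma_converges X d J Jinf \<longleftrightarrow>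
    (\<forall>p :: nat \<Rightarrow> real. (\<forall>k. 1 \<le> p k) \<and> filterlim p at_top sequentially \<longrightarrow>
      (\<forall>x\<in>X. \<forall>u. (\<forall>k. u k \<in> X) \<and> (\<lambda>k. d (u k) x) \<longlonglongrightarrow> 0 \<longrightarrow>
          ereal (Jinf x) \<le> liminf (\<lambda>k. ereal (J (p k) (u k)))) \<and>
      (\<forall>x\<in>X. \<exists>u. (\<forall>k. u k \<in> X) \<and> (\<lambda>k. d (u k) x) \<longlonglongrightarrow> 0 \<and>
          limsup (\<lambda>k. ereal (J (p k) (u k))) \<le> ereal (Jinf x)))"


section \<open>The variational problem\<close>

text \<open>
  For \<open>c = 0\<close> the members may have empty interior; the empty set is excluded.
\<close>

definition convex_subbodies :: "'a::euclidean_space set \<Rightarrow> real \<Rightarrow> 'a set set" where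
  "convex_subbodies \<Omega> c =
    {\<omega>. \<omega> \<noteq> {} \<and> compact \<omega> \<and> convex \<omega> \<and> \<omega> \<subseteq> \<Omega> \<and> measure lebesgue \<omega> = c}"

definition J_fun :: "'a::euclidean_space set \<Rightarrow> real \<Rightarrow> 'a set \<Rightarrow> real" where
  "J_fun \<Omega> p \<omega> =
    (LINT \<theta>:sphere 0 1|hausdorff_measure (DIM('a) - 1).
       \<bar>support_fun \<Omega> \<theta> - support_fun \<omega> \<theta>\<bar> powr p) powr (1 / p)"

definition J_inf :: "'a::euclidean_space set \<Rightarrow> 'a set \<Rightarrow> real" where
  "J_inf \<Omega> \<omega> = hausdorff_dist \<omega> \<Omega>"

end

theory Submission
  imports Defs "HOL-Complex_Analysis.Great_Picard"
begin

text \<open>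
  The class \<open>K\<close> is sequentially compact for the Hausdorff distance: Blaschke's selection theorem
  gives a limit, and since frontiers of convex sets are negligible the volume passes to the limit.
  Each \<open>J\<^sub>p\<close> is continuous on \<open>K\<close> by dominated convergence, so minimisers exist.
  As the sphere has finite Hausdorff measure \<open>m\<close>, \<open>J\<^sub>p \<le> m powr (1 / p) * J\<^sub>\<infinity>\<close>, and constant
  recovery sequences suffice. For the lower bound, \<open>\<bar>h\<^sub>\<Omega> - h\<^sub>\<omega>\<bar>\<close> exceeds any number below its
  maximum on a relatively open subset of the sphere, uniformly for nearby \<open>\<omega>\<close>; such a subset has
  positive Hausdorff measure, because otherwise the cone over it would be Lebesgue negligible.
\<close>


section \<open>Compactness of the class of competitors\<close>

text \<open>Hausdorff measure is defined by coverings, and only two properties of it on the sphere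
  matter: finiteness, and positivity on relatively open sets. Both are obtained by comparison with
  Lebesgue measure of solid regions, so crude constants suffice. The dependence on \<open>p\<close>
  is condensed into two strict comparisons with a number \<open>a\<close>: for a fixed competitor
  \<open>J_fun\<close> is eventually below any \<open>a\<close> above its \<open>J_inf\<close>, and
  along a convergent sequence it is eventually above any \<open>a\<close> below the
  \<open>J_inf\<close> of the limit. \<Gamma>-convergence is this pair restated. Convergence of the
  infima combines the pair with sequential compactness of the class, and minimality of accumulation
  points combines it with closedness.\<close>

lemma inner_le_support_fun:
  assumes "bounded K" "y \<in> K"
  shows "\<theta> \<bullet> y \<le> support_fun K \<theta>"
proof -
  obtain B where "\<And>x. x \<in> K \<Longrightarrow> norm x \<le> B"
    using \<open>bounded K\<close> by (auto simp: bounded_iff)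
  then have "\<theta> \<bullet> x \<le> norm \<theta> * B" if "x \<in> K" for x
    using that norm_cauchy_schwarz[of \<theta> x] by (meson mult_left_mono norm_ge_zero order_trans)
  then have "bdd_above ((\<bullet>) \<theta> ` K)"
    by (auto intro!: bdd_aboveI)
  then show ?thesis
    unfolding support_fun_def using \<open>y \<in> K\<close> by (rule cSUP_upper2) simp
qed

lemma support_fun_least:
  assumes "K \<noteq> {}" "\<And>y. y \<in> K \<Longrightarrow> \<theta> \<bullet> y \<le> b"
  shows "support_fun K \<theta> \<le> b"
  unfolding support_fun_def using assms by (rule cSUP_least)

text \<open>Each map \<open>\<theta> \<mapsto> \<theta> \<bullet> y\<close> is Lipschitz with
  constant \<open>norm y\<close>, and a supremum of functions with a common Lipschitz constant
  inherits that constant.\<close>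

lemma continuous_on_support_fun:
  fixes K :: "'a::real_inner set"
  assumes "bounded K" "K \<noteq> {}"
  shows "continuous_on A (support_fun K)"
proof -
  obtain B where B: "\<And>x. x \<in> K \<Longrightarrow> norm x \<le> B" and "0 < B"
    using \<open>bounded K\<close> by (auto simp: bounded_pos)
  have *: "support_fun K \<theta> \<le> support_fun K \<eta> + B * norm (\<theta> - \<eta>)" for \<theta> \<eta>
  proof (rule support_fun_least[OF \<open>K \<noteq> {}\<close>])
    fix y assume y: "y \<in> K"
    have "\<theta> \<bullet> y = \<eta> \<bullet> y + (\<theta> - \<eta>) \<bullet> y"
      by (simp add: inner_diff_left)
    also have "(\<theta> - \<eta>) \<bullet> y \<le> norm (\<theta> - \<eta>) * norm y"
      by (rule norm_cauchy_schwarz)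
    also have "\<dots> \<le> B * norm (\<theta> - \<eta>)"
      using B[OF y] by (simp add: mult.commute mult_right_mono)
    finally show "\<theta> \<bullet> y \<le> support_fun K \<eta> + B * norm (\<theta> - \<eta>)"
      using inner_le_support_fun[OF \<open>bounded K\<close> y, of \<eta>] by simp
  qed
  have "B-lipschitz_on A (support_fun K)"
  proof (rule lipschitz_onI)
    fix \<theta> \<eta>
    show "dist (support_fun K \<theta>) (support_fun K \<eta>) \<le> B * dist \<theta> \<eta>"
      using *[of \<theta> \<eta>] *[of \<eta> \<theta>] by (simp add: dist_norm norm_minus_commute abs_le_iff)
  qed (use \<open>0 < B\<close> in simp)
  then show ?thesis
    by (rule lipschitz_on_continuous_on)
qed

section \<open>Hausdorff distance in terms of support functions\<close>

lemma hausdorff_dist_commute: "hausdorff_dist X Y = hausdorff_dist Y X"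
  by (simp add: hausdorff_dist_def max.commute)

lemma infdist_le_hausdorff_dist:
  assumes "bounded X" "bounded Y" "Y \<noteq> {}" "x \<in> X"
  shows "infdist x Y \<le> hausdorff_dist X Y"
proof -
  obtain y where "y \<in> Y"
    using \<open>Y \<noteq> {}\<close> by blast
  \<comment> \<open>A real supremum is informative only over a bounded set; the distances to the
    single point \<open>y\<close> bound all values.\<close>
  obtain B where "\<And>z. z \<in> X \<Longrightarrow> dist y z \<le> B"
    using \<open>bounded X\<close> by (auto simp: bounded_any_center[of _ y])
  then have "bdd_above ((\<lambda>x. infdist x Y) ` X)"
    using \<open>y \<in> Y\<close> by (intro bdd_aboveI[of _ B]) (auto simp: dist_commute intro: infdist_le2)
  then have "infdist x Y \<le> (SUP x\<in>X. infdist x Y)"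
    using \<open>x \<in> X\<close> by (rule cSUP_upper2) simp
  then show ?thesis
    by (simp add: hausdorff_dist_def)
qed

lemma hausdorff_dist_le:
  assumes "X \<noteq> {}" "Y \<noteq> {}"
    and "\<And>x. x \<in> X \<Longrightarrow> infdist x Y \<le> e" "\<And>y. y \<in> Y \<Longrightarrow> infdist y X \<le> e"
  shows "hausdorff_dist X Y \<le> e"
  unfolding hausdorff_dist_def using assms by (auto intro!: cSUP_least)

lemma hausdorff_dist_nonneg:
  assumes "bounded X" "bounded Y" "X \<noteq> {}" "Y \<noteq> {}"
  shows "0 \<le> hausdorff_dist X Y"
  using assms by (metis all_not_in_conv infdist_le_hausdorff_dist infdist_nonneg order_trans)

lemma hausdorff_dist_self:
  assumes "bounded X" "X \<noteq> {}"
  shows "hausdorff_dist X X = 0"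
  using assms by (intro antisym hausdorff_dist_nonneg hausdorff_dist_le) auto

text \<open>Passing from \<open>x\<close> to its nearest point in \<open>Y\<close> changes the
  product with a unit vector by at most the distance moved.\<close>

lemma support_fun_le_add_hausdorff_dist:
  fixes X Y :: "'a::euclidean_space set"
  assumes X: "bounded X" "X \<noteq> {}" and Y: "compact Y" "Y \<noteq> {}" and "norm \<theta> = 1"
  shows "support_fun X \<theta> \<le> support_fun Y \<theta> + hausdorff_dist X Y"
proof (rule support_fun_least[OF \<open>X \<noteq> {}\<close>])
  fix x assume x: "x \<in> X"
  have "closed Y"
    using Y by (simp add: compact_imp_closed)
  then obtain y where y: "y \<in> Y" "infdist x Y = dist x y"
    using infdist_attains_inf[of Y x] \<open>Y \<noteq> {}\<close> by blast
  have "\<theta> \<bullet> x = \<theta> \<bullet> y + \<theta> \<bullet> (x - y)"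
    by (simp add: inner_diff_right)
  also have "\<dots> \<le> support_fun Y \<theta> + norm (x - y)"
    using inner_le_support_fun[of Y y \<theta>] norm_cauchy_schwarz[of \<theta> "x - y"] y Y \<open>norm \<theta> = 1\<close>
    by (auto intro!: add_mono compact_imp_bounded)
  also have "norm (x - y) \<le> hausdorff_dist X Y"
    using infdist_le_hausdorff_dist[of X Y x] x X Y y by (simp add: dist_norm compact_imp_bounded)
  finally show "\<theta> \<bullet> x \<le> support_fun Y \<theta> + hausdorff_dist X Y"
    by simp
qed

lemma abs_support_fun_diff_le:
  fixes X Y :: "'a::euclidean_space set"
  assumes "compact X" "X \<noteq> {}" "compact Y" "Y \<noteq> {}" "norm \<theta> = 1"
  shows "\<bar>support_fun X \<theta> - support_fun Y \<theta>\<bar> \<le> hausdorff_dist X Y"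
  using assms support_fun_le_add_hausdorff_dist[of X Y \<theta>] support_fun_le_add_hausdorff_dist[of Y X \<theta>]
  by (simp add: compact_imp_bounded hausdorff_dist_commute[of Y X] abs_le_iff)

text \<open>The direction points from the nearest point of \<open>Y\<close> towards
  \<open>x\<close>. By convexity the hyperplane through the nearest point orthogonal to it supports
  \<open>Y\<close>, so \<open>x\<close> lies above it by exactly its distance from
  \<open>Y\<close>.\<close>

lemma infdist_support_direction:
  fixes Y :: "'a::euclidean_space set"
  assumes "compact Y" "convex Y" "Y \<noteq> {}" "x \<notin> Y"
  obtains \<theta> where "norm \<theta> = 1" "support_fun Y \<theta> + infdist x Y \<le> \<theta> \<bullet> x"
proof -
  have "closed Y"
    using assms by (simp add: compact_imp_closed)
  then obtain y where y: "y \<in> Y" "infdist x Y = dist x y"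
    using infdist_attains_inf[of Y x] \<open>Y \<noteq> {}\<close> by blast
  have "x \<noteq> y"
    using y \<open>x \<notin> Y\<close> by blast
  define \<theta> where "\<theta> = (x - y) /\<^sub>R norm (x - y)"
  have "(x - y) \<bullet> (z - y) \<le> 0" if "z \<in> Y" for z
    using assms(2) \<open>closed Y\<close> \<open>y \<in> Y\<close> that
    by (rule any_closest_point_dot) (metis infdist_le y(2))
  then have "\<theta> \<bullet> (z - y) \<le> 0" if "z \<in> Y" for z
    using that \<open>x \<noteq> y\<close> by (simp add: \<theta>_def divide_nonpos_pos mult_nonneg_nonpos)
  then have "support_fun Y \<theta> \<le> \<theta> \<bullet> y"
    using \<open>Y \<noteq> {}\<close> by (intro support_fun_least) (auto simp: inner_diff_right)
  moreover have "\<theta> \<bullet> (x - y) = dist x y"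
    using \<open>x \<noteq> y\<close> by (simp add: \<theta>_def dist_norm dot_square_norm power2_eq_square)
  moreover have "norm \<theta> = 1"
    using \<open>x \<noteq> y\<close> by (simp add: \<theta>_def)
  ultimately show ?thesis
    using that[of \<theta>] y(2) by (simp add: inner_diff_right)
qed

text \<open>Because of the inclusion only points of \<open>Y\<close> contribute to the distance. The
  direction is the one separating a farthest point of \<open>Y\<close> from
  \<open>X\<close>.\<close>

lemma hausdorff_dist_eq_support_fun_diff:
  fixes X Y :: "'a::euclidean_space set"
  assumes "compact X" "convex X" "X \<noteq> {}" "compact Y" "X \<subseteq> Y"
  obtains \<theta> where "norm \<theta> = 1" "hausdorff_dist X Y = \<bar>support_fun Y \<theta> - support_fun X \<theta>\<bar>"
proof -
  have "Y \<noteq> {}"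
    using assms by blast
  have le: "\<bar>support_fun Y \<theta> - support_fun X \<theta>\<bar> \<le> hausdorff_dist X Y" if "norm \<theta> = 1" for \<theta>
    using abs_support_fun_diff_le[of X Y \<theta>] assms \<open>Y \<noteq> {}\<close> that by (simp add: abs_minus_commute)
  obtain y where y: "y \<in> Y" "\<And>z. z \<in> Y \<Longrightarrow> infdist z X \<le> infdist y X"
    using continuous_attains_sup[OF \<open>compact Y\<close> \<open>Y \<noteq> {}\<close>
        continuous_on_infdist[OF continuous_on_id, of _ X]] by blast
  have d: "hausdorff_dist X Y \<le> infdist y X"
  proof (rule hausdorff_dist_le)
    fix x assume "x \<in> X"
    then show "infdist x Y \<le> infdist y X"
      using \<open>X \<subseteq> Y\<close> by (metis infdist_nonneg infdist_zero subsetD)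
  qed (use assms \<open>Y \<noteq> {}\<close> y in auto)
  show ?thesis
  proof (cases "y \<in> X")
    \<comment> \<open>The distance is 0 here, and \<open>le\<close> forces the difference to vanish
      in every direction.\<close>
    case True
    obtain \<theta> :: 'a where "norm \<theta> = 1"
      using vector_choose_size[of 1] by auto
    then show ?thesis
      using that[of \<theta>] le[of \<theta>] d True by simp
  next
    case False
    then obtain \<theta> where \<theta>: "norm \<theta> = 1" "support_fun X \<theta> + infdist y X \<le> \<theta> \<bullet> y"
      using infdist_support_direction[of X y] assms by blast
    have "\<theta> \<bullet> y \<le> support_fun Y \<theta>"
      using assms y by (intro inner_le_support_fun) (auto intro: compact_imp_bounded)
    then show ?thesis
      using that[of \<theta>] le[of \<theta>] d \<theta> by simp
  qed
qed

text \<open>If \<open>x\<close> were outside \<open>Y\<close>, moving it by \<open>r\<close> in the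
  separating direction would reach a point of \<open>X\<close> exceeding the support function of
  \<open>Y\<close> by at least \<open>r\<close>. This puts interior points of a limit into all late
  members of the sequence.\<close>

lemma mem_if_cball_subset_hausdorff_dist_less:
  fixes X Y :: "'a::euclidean_space set"
  assumes "compact X" "X \<noteq> {}" "compact Y" "convex Y" "Y \<noteq> {}"
    and "cball x r \<subseteq> X" "hausdorff_dist Y X < r"
  shows "x \<in> Y"
proof (rule ccontr)
  assume "x \<notin> Y"
  then obtain \<theta> where \<theta>: "norm \<theta> = 1" "support_fun Y \<theta> + infdist x Y \<le> \<theta> \<bullet> x"
    using infdist_support_direction[of Y x] assms by blast
  have "0 \<le> r"
    using assms hausdorff_dist_nonneg[of Y X] by (simp add: compact_imp_bounded)
  then have "x + r *\<^sub>R \<theta> \<in> X"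
    using \<theta> assms by (intro subsetD[OF \<open>cball x r \<subseteq> X\<close>]) (simp add: dist_norm)
  then have "\<theta> \<bullet> (x + r *\<^sub>R \<theta>) \<le> support_fun X \<theta>"
    using assms by (intro inner_le_support_fun) (auto intro: compact_imp_bounded)
  moreover have "\<theta> \<bullet> (x + r *\<^sub>R \<theta>) = \<theta> \<bullet> x + r"
    using \<theta> by (simp add: inner_add_right dot_square_norm)
  moreover have "support_fun X \<theta> \<le> support_fun Y \<theta> + hausdorff_dist X Y"
    using assms \<theta> by (intro support_fun_le_add_hausdorff_dist) (auto intro: compact_imp_bounded)
  ultimately show False
    using \<theta> infdist_nonneg[of x Y] assms(7) by (simp add: hausdorff_dist_commute[of Y X])
qed

section \<open>Convexity, inclusion and volume under Hausdorff limits\<close>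

lemma convex_hausdorff_limit:
  fixes \<omega> :: "'a::euclidean_space set"
  assumes u: "\<And>k. compact (u k)" "\<And>k. convex (u k)" "\<And>k. u k \<noteq> {}"
    and \<omega>: "compact \<omega>" "\<omega> \<noteq> {}"
    and lim: "(\<lambda>k. hausdorff_dist (u k) \<omega>) \<longlonglongrightarrow> 0"
  shows "convex \<omega>"
proof (rule convexI)
  fix x y and s t :: real
  assume x: "x \<in> \<omega>" and y: "y \<in> \<omega>" and st: "0 \<le> s" "0 \<le> t" "s + t = 1"
  let ?z = "s *\<^sub>R x + t *\<^sub>R y"
  have near: "\<exists>x'\<in>u k. dist x x' \<le> hausdorff_dist (u k) \<omega>" if "x \<in> \<omega>" for x k
    using infdist_attains_inf[of "u k" x] u \<omega> that infdist_le_hausdorff_dist[of \<omega> "u k" x]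
    by (metis compact_imp_bounded compact_imp_closed hausdorff_dist_commute)
  \<comment> \<open>One half of the bound moves \<open>?z\<close> to the same combination of near
    points, which lies in the convex set \<open>u k\<close>; the other half moves from there back to
    \<omega>.\<close>
  have le: "infdist ?z \<omega> \<le> 2 * hausdorff_dist (u k) \<omega>" for k
  proof -
    obtain x' where x': "x' \<in> u k" "dist x x' \<le> hausdorff_dist (u k) \<omega>"
      using near[OF x] by blast
    obtain y' where y': "y' \<in> u k" "dist y y' \<le> hausdorff_dist (u k) \<omega>"
      using near[OF y] by blast
    have "s *\<^sub>R x' + t *\<^sub>R y' \<in> u k"
      using u(2)[of k] x' y' st by (simp add: convex_def)
    then have "infdist (s *\<^sub>R x' + t *\<^sub>R y') \<omega> \<le> hausdorff_dist (u k) \<omega>"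
      using u \<omega> by (intro infdist_le_hausdorff_dist compact_imp_bounded) auto
    moreover have "dist ?z (s *\<^sub>R x' + t *\<^sub>R y') \<le> hausdorff_dist (u k) \<omega>"
    proof -
      have "?z - (s *\<^sub>R x' + t *\<^sub>R y') = s *\<^sub>R (x - x') + t *\<^sub>R (y - y')"
        by (simp add: algebra_simps)
      then have "dist ?z (s *\<^sub>R x' + t *\<^sub>R y') \<le> s * dist x x' + t * dist y y'"
        using norm_triangle_ineq[of "s *\<^sub>R (x - x')" "t *\<^sub>R (y - y')"] st by (simp add: dist_norm)
      also have "\<dots> \<le> s * hausdorff_dist (u k) \<omega> + t * hausdorff_dist (u k) \<omega>"
        using x' y' st by (intro add_mono mult_left_mono) auto
      also have "\<dots> = hausdorff_dist (u k) \<omega>"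
        using st by (simp add: distrib_right[symmetric])
      finally show ?thesis .
    qed
    ultimately show ?thesis
      using infdist_triangle[of ?z \<omega> "s *\<^sub>R x' + t *\<^sub>R y'"] by simp
  qed
  have "(\<lambda>k. 2 * hausdorff_dist (u k) \<omega>) \<longlonglongrightarrow> 0"
    using tendsto_mult_left[OF lim, of 2] by simp
  then have "infdist ?z \<omega> \<le> 0"
    by (rule LIMSEQ_le_const) (simp add: le)
  then show "?z \<in> \<omega>"
    using \<omega> infdist_nonneg[of ?z \<omega>] by (simp add: in_closed_iff_infdist_zero compact_imp_closed)
qed

lemma subset_hausdorff_limit:
  fixes \<omega> :: "'a::euclidean_space set"
  assumes u: "\<And>k. compact (u k)" "\<And>k. u k \<noteq> {}" "\<And>k. u k \<subseteq> \<Omega>"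
    and "closed \<Omega>" and \<omega>: "compact \<omega>"
    and lim: "(\<lambda>k. hausdorff_dist (u k) \<omega>) \<longlonglongrightarrow> 0"
  shows "\<omega> \<subseteq> \<Omega>"
proof
  fix x assume x: "x \<in> \<omega>"
  have le: "infdist x \<Omega> \<le> hausdorff_dist (u k) \<omega>" for k
  proof -
    have "infdist x \<Omega> \<le> infdist x (u k)"
      using u by (intro infdist_mono)
    also have "\<dots> \<le> hausdorff_dist \<omega> (u k)"
      using u \<omega> x by (intro infdist_le_hausdorff_dist compact_imp_bounded) auto
    finally show ?thesis
      by (simp add: hausdorff_dist_commute)
  qed
  have "infdist x \<Omega> \<le> 0"
    using lim by (rule LIMSEQ_le_const) (simp add: le)
  moreover have "\<Omega> \<noteq> {}"
    using u(2,3)[of 0] by blast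
  ultimately show "x \<in> \<Omega>"
    using \<open>closed \<Omega>\<close> infdist_nonneg[of x \<Omega>] by (simp add: in_closed_iff_infdist_zero)
qed

text \<open>Off the negligible frontier of the limit the indicator functions converge pointwise.\<close>

lemma measure_hausdorff_limit:
  fixes \<omega> :: "'a::euclidean_space set"
  assumes u: "\<And>k. compact (u k)" "\<And>k. convex (u k)" "\<And>k. u k \<noteq> {}" "\<And>k. u k \<subseteq> \<Omega>"
    and "compact \<Omega>" and \<omega>: "compact \<omega>" "\<omega> \<noteq> {}"
    and lim: "(\<lambda>k. hausdorff_dist (u k) \<omega>) \<longlonglongrightarrow> 0"
  shows "(\<lambda>k. measure lebesgue (u k)) \<longlonglongrightarrow> measure lebesgue \<omega>"
proof -
  have "convex \<omega>"
    by (rule convex_hausdorff_limit[of u]) (use u \<omega> lim in auto)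
  have conv: "(\<lambda>k. indicator (u k) x :: real) \<longlonglongrightarrow> indicator \<omega> x" if "x \<notin> frontier \<omega>" for x
  proof (cases "x \<in> interior \<omega>")
    case True
    then obtain r where r: "0 < r" "cball x r \<subseteq> \<omega>"
      by (auto simp: mem_interior_cball)
    have "\<forall>\<^sub>F k in sequentially. indicator (u k) x = (indicator \<omega> x :: real)"
      using order_tendstoD(2)[OF lim \<open>0 < r\<close>]
    proof eventually_elim
      case (elim k)
      have "x \<in> u k"
        using \<omega> u(1-3) r(2) elim by (rule mem_if_cball_subset_hausdorff_dist_less[of \<omega> "u k" x r])
      moreover have "x \<in> \<omega>"
        using True interior_subset by blast
      ultimately show ?case by simp
    qed
    then show ?thesis
      by (rule tendsto_eventually)
  next
    case False
    have "closed \<omega>"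
      using \<omega> by (simp add: compact_imp_closed)
    then have "x \<notin> \<omega>"
      using False that by (simp add: frontier_def)
    then have "0 < infdist x \<omega>"
      using \<omega> \<open>closed \<omega>\<close> by (simp add: infdist_pos_not_in_closed)
    have "\<forall>\<^sub>F k in sequentially. indicator (u k) x = (indicator \<omega> x :: real)"
      using order_tendstoD(2)[OF lim \<open>0 < infdist x \<omega>\<close>]
    proof eventually_elim
      case (elim k)
      have "x \<notin> u k"
        using elim infdist_le_hausdorff_dist[of "u k" \<omega> x] u \<omega> by (auto simp: compact_imp_bounded)
      with \<open>x \<notin> \<omega>\<close> show ?case by simp
    qed
    then show ?thesis
      by (rule tendsto_eventually)
  qed
  have "(\<lambda>k. integral\<^sup>L lebesgue (indicat_real (u k))) \<longlonglongrightarrow> integral\<^sup>L lebesgue (indicat_real \<omega>)"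
  proof (rule integral_dominated_convergence)
    \<comment> \<open>All the sets lie in \<Omega>, whose indicator therefore dominates.\<close>
    show "integrable lebesgue (indicat_real \<Omega>)"
      using \<open>compact \<Omega>\<close> by (simp add: lmeasurable_compact lmeasurable_iff_integrable[symmetric])
    have "frontier \<omega> \<in> null_sets lebesgue"
      using negligible_convex_frontier[OF \<open>convex \<omega>\<close>] by (simp add: negligible_iff_null_sets)
    then show "AE x in lebesgue. (\<lambda>k. indicat_real (u k) x) \<longlonglongrightarrow> indicat_real \<omega> x"
      by (rule AE_I') (use conv in blast)
    show "AE x in lebesgue. norm (indicat_real (u k) x) \<le> indicat_real \<Omega> x" for k
      using u(4)[of k] by (auto simp: indicator_def)
    show "indicat_real \<omega> \<in> borel_measurable lebesgue"
      using \<omega> by (intro borel_measurable_indicator) (simp add: lmeasurable_compact fmeasurableD)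
    show "indicat_real (u k) \<in> borel_measurable lebesgue" for k
      using u(1)[of k] by (intro borel_measurable_indicator) (simp add: lmeasurable_compact fmeasurableD)
  qed
  then show ?thesis
    by simp
qed

text \<open>
  Blaschke's selection theorem. The distance functions of the sets are 1-Lipschitz and uniformly
  bounded; the limit of a uniformly convergent subsequence is the distance function of its zero set.
\<close>

lemma hausdorff_dist_compact:
  fixes u :: "nat \<Rightarrow> 'a::euclidean_space set"
  assumes "compact \<Omega>" and u: "\<And>k. compact (u k)" "\<And>k. u k \<noteq> {}" "\<And>k. u k \<subseteq> \<Omega>"
  obtains r \<omega> where "strict_mono (r :: nat \<Rightarrow> nat)" "compact \<omega>" "\<omega> \<noteq> {}"
    "(\<lambda>k. hausdorff_dist (u (r k)) \<omega>) \<longlonglongrightarrow> 0"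
proof -
  have inf_le: "infdist x (u k) \<le> diameter \<Omega>" if "x \<in> \<Omega>" for k x
  proof -
    obtain y where "y \<in> u k"
      using u(2)[of k] by blast
    then have "dist x y \<le> diameter \<Omega>"
      using u(3)[of k] that \<open>compact \<Omega>\<close> by (intro diameter_bounded_bound compact_imp_bounded) auto
    then show ?thesis
      using \<open>y \<in> u k\<close> by (rule infdist_le2[rotated])
  qed
  obtain g r where g: "continuous_on \<Omega> g" and r: "strict_mono (r :: nat \<Rightarrow> nat)"
    and unif: "\<And>e. 0 < e \<Longrightarrow>
      \<exists>N. \<forall>n x. N \<le> n \<and> x \<in> \<Omega> \<longrightarrow> norm (infdist x (u (r n)) - g x) < e"
  proof (rule Arzela_Ascoli[of \<Omega> "\<lambda>k x. infdist x (u k)" "diameter \<Omega>"])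
    fix x and e :: real assume "x \<in> \<Omega>" "0 < e"
    have "norm (infdist x (u n) - infdist y (u n)) < e" if "norm (x - y) < e" for n y
      using infdist_triangle_abs[of x "u n" y] that by (simp add: dist_norm)
    then show "\<exists>d>0. \<forall>n y. y \<in> \<Omega> \<and> norm (x - y) < d \<longrightarrow>
        norm (infdist x (u n) - infdist y (u n)) < e"
      using \<open>0 < e\<close> by blast
  qed (use \<open>compact \<Omega>\<close> inf_le in \<open>auto simp: infdist_nonneg\<close>)
  have pw: "(\<lambda>k. infdist x (u (r k))) \<longlonglongrightarrow> g x" if "x \<in> \<Omega>" for x
  proof (rule LIMSEQ_I)
    fix e :: real assume "0 < e"
    then show "\<exists>N. \<forall>n\<ge>N. norm (infdist x (u (r n)) - g x) < e"
      using unif[of e] that by blast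
  qed
  define \<omega> where "\<omega> = {x\<in>\<Omega>. g x = 0}"
  have "closed \<omega>"
    unfolding \<omega>_def using g \<open>compact \<Omega>\<close>
    by (intro continuous_closed_preimage_constant compact_imp_closed)
  then have "compact \<omega>"
    using closed_Int_compact[of \<omega> \<Omega>] \<open>compact \<Omega>\<close> by (simp add: \<omega>_def Int_def conj_commute)
  \<comment> \<open>The points of \<open>u (r k)\<close> nearest to \<open>x\<close> accumulate at
    some \<open>z\<close>. Lying in these sets, they force \<open>g z = 0\<close>, and their
    distances to \<open>x\<close> tend to \<open>g x\<close>. Thus \<open>g\<close> dominates the
    distance to \<omega>.\<close>
  have zero: "\<exists>y\<in>\<omega>. dist x y \<le> g x" if x: "x \<in> \<Omega>" for x
  proof -
    have "\<exists>y\<in>u (r k). infdist x (u (r k)) = dist x y" for k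
      using infdist_attains_inf[of "u (r k)" x] u by (metis compact_imp_closed)
    then obtain y where y: "\<And>k. y k \<in> u (r k)" "\<And>k. infdist x (u (r k)) = dist x (y k)"
      by metis
    have y\<Omega>: "y k \<in> \<Omega>" for k
      using y(1)[of k] u(3) by blast
    then obtain z q where z: "z \<in> \<Omega>" "strict_mono (q :: nat \<Rightarrow> nat)" "(y \<circ> q) \<longlonglongrightarrow> z"
      using \<open>compact \<Omega>\<close> by (metis compact_def)
    have "(\<lambda>k. infdist z (u (r (q k)))) \<longlonglongrightarrow> g z"
      using LIMSEQ_subseq_LIMSEQ[OF pw[OF \<open>z \<in> \<Omega>\<close>] z(2)] by (simp add: o_def)
    moreover have "(\<lambda>k. infdist z (u (r (q k)))) \<longlonglongrightarrow> 0"
    proof (rule tendsto_sandwich[of "\<lambda>_. 0" _ _ "\<lambda>k. dist z ((y \<circ> q) k)"])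
      show "\<forall>\<^sub>F k in sequentially. infdist z (u (r (q k))) \<le> dist z ((y \<circ> q) k)"
        using y(1) by (simp add: infdist_le)
      show "(\<lambda>k. dist z ((y \<circ> q) k)) \<longlonglongrightarrow> 0"
        using tendsto_dist[OF tendsto_const z(3), of z] by simp
    qed (auto simp: infdist_nonneg)
    ultimately have "g z = 0"
      by (rule LIMSEQ_unique)
    moreover have "dist x z = g x"
    proof (rule LIMSEQ_unique)
      show "(\<lambda>k. dist x ((y \<circ> q) k)) \<longlonglongrightarrow> dist x z"
        by (intro tendsto_dist tendsto_const z)
      show "(\<lambda>k. dist x ((y \<circ> q) k)) \<longlonglongrightarrow> g x"
        using LIMSEQ_subseq_LIMSEQ[OF pw[OF x] z(2)] by (simp add: o_def y(2))
    qed
    ultimately show ?thesis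
      using \<open>z \<in> \<Omega>\<close> by (auto simp: \<omega>_def)
  qed
  have "\<Omega> \<noteq> {}"
    using u(2,3)[of 0] by blast
  then have "\<omega> \<noteq> {}"
    using zero by blast
  have "(\<lambda>k. hausdorff_dist (u (r k)) \<omega>) \<longlonglongrightarrow> 0"
  proof (rule LIMSEQ_I)
    fix e :: real assume "0 < e"
    then obtain N where N: "\<And>n x. N \<le> n \<Longrightarrow> x \<in> \<Omega> \<Longrightarrow> \<bar>infdist x (u (r n)) - g x\<bar> < e / 2"
      using unif[of "e / 2"] by auto
    have "norm (hausdorff_dist (u (r n)) \<omega> - 0) < e" if "N \<le> n" for n
    proof -
      \<comment> \<open>Uniform closeness is used twice: on \<open>u (r n)\<close> its own distance
        function vanishes, so \<open>g\<close> is small there; on \<omega> it is \<open>g\<close>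
        that vanishes.\<close>
      have "hausdorff_dist (u (r n)) \<omega> \<le> e / 2"
      proof (rule hausdorff_dist_le)
        fix x assume x: "x \<in> u (r n)"
        then have "x \<in> \<Omega>"
          using u(3) by blast
        then obtain y where "y \<in> \<omega>" "dist x y \<le> g x"
          using zero by blast
        then have "infdist x \<omega> \<le> g x"
          by (rule infdist_le2)
        then show "infdist x \<omega> \<le> e / 2"
          using N[OF that \<open>x \<in> \<Omega>\<close>] x by simp
      next
        fix y assume "y \<in> \<omega>"
        then show "infdist y (u (r n)) \<le> e / 2"
          using N[OF that, of y] by (simp add: \<omega>_def)
      qed (use u \<open>\<omega> \<noteq> {}\<close> in auto)
      moreover have "0 \<le> hausdorff_dist (u (r n)) \<omega>"
        using u \<open>compact \<omega>\<close> \<open>\<omega> \<noteq> {}\<close> by (intro hausdorff_dist_nonneg compact_imp_bounded) auto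
      ultimately show ?thesis
        using \<open>0 < e\<close> by simp
    qed
    then show "\<exists>N. \<forall>n\<ge>N. norm (hausdorff_dist (u (r n)) \<omega> - 0) < e"
      by blast
  qed
  then show ?thesis
    using that r \<open>compact \<omega>\<close> \<open>\<omega> \<noteq> {}\<close> by blast
qed

text \<open>Membership of the limit is a conclusion, so that this serves both for limits from
  Blaschke selection and for accumulation points of minimisers. Volumes along the sequence are
  constantly \<open>c\<close>, which fixes the volume of the limit.\<close>

lemma convex_subbodies_closed:
  fixes \<Omega> :: "'a::euclidean_space set"
  assumes "compact \<Omega>" and u: "\<And>k. u k \<in> convex_subbodies \<Omega> c"
    and "compact \<omega>" "\<omega> \<noteq> {}" and lim: "(\<lambda>k. hausdorff_dist (u k) \<omega>) \<longlonglongrightarrow> 0"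
  shows "\<omega> \<in> convex_subbodies \<Omega> c"
proof -
  have u': "compact (u k)" "convex (u k)" "u k \<noteq> {}" "u k \<subseteq> \<Omega>" "measure lebesgue (u k) = c" for k
    using u[of k] by (auto simp: convex_subbodies_def)
  have "convex \<omega>"
    by (rule convex_hausdorff_limit[of u]) (use assms u' in auto)
  moreover have "\<omega> \<subseteq> \<Omega>"
    by (rule subset_hausdorff_limit[of u]) (use assms u' in \<open>auto simp: compact_imp_closed\<close>)
  moreover have "(\<lambda>k. measure lebesgue (u k)) \<longlonglongrightarrow> measure lebesgue \<omega>"
    by (rule measure_hausdorff_limit[of u \<Omega>]) (use assms u' in auto)
  then have "measure lebesgue \<omega> = c"
    by (simp add: u' tendsto_const_iff)
  ultimately show ?thesis
    using assms by (simp add: convex_subbodies_def)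
qed

lemma convex_subbodies_compact:
  fixes \<Omega> :: "'a::euclidean_space set"
  assumes "compact \<Omega>" and u: "\<And>k. u k \<in> convex_subbodies \<Omega> c"
  obtains r \<omega> where "strict_mono (r :: nat \<Rightarrow> nat)" "\<omega> \<in> convex_subbodies \<Omega> c"
    "(\<lambda>k. hausdorff_dist (u (r k)) \<omega>) \<longlonglongrightarrow> 0"
proof -
  have u': "compact (u k)" "u k \<noteq> {}" "u k \<subseteq> \<Omega>" for k
    using u[of k] by (auto simp: convex_subbodies_def)
  obtain r \<omega> where r: "strict_mono (r :: nat \<Rightarrow> nat)" "compact \<omega>" "\<omega> \<noteq> {}"
    "(\<lambda>k. hausdorff_dist (u (r k)) \<omega>) \<longlonglongrightarrow> 0"
    using hausdorff_dist_compact[of \<Omega> u] \<open>compact \<Omega>\<close> u' by blast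
  moreover have "\<omega> \<in> convex_subbodies \<Omega> c"
    using \<open>compact \<Omega>\<close> u r(2-) by (rule convex_subbodies_closed[of \<Omega> "\<lambda>k. u (r k)"])
  ultimately show ?thesis
    using that by blast
qed

text \<open>The witness is a homothetic copy of the container.\<close>

lemma convex_subbodies_nonempty:
  fixes \<Omega> :: "'a::euclidean_space set"
  assumes "compact \<Omega>" "convex \<Omega>" "interior \<Omega> \<noteq> {}" "0 \<le> c" "c \<le> measure lebesgue \<Omega>"
  shows "convex_subbodies \<Omega> c \<noteq> {}"
proof -
  have "\<not> negligible \<Omega>"
    using assms by (metis negligible_subset interior_subset open_interior open_not_negligible)
  then have pos: "0 < measure lebesgue \<Omega>"
    using \<open>compact \<Omega>\<close> by (simp add: lmeasurable_compact negligible_iff_measure zero_less_measure_iff)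
  obtain a where a: "a \<in> \<Omega>"
    using assms interior_subset by blast
  \<comment> \<open>Volume scales with the power \<open>DIM('a)\<close> of the ratio, which dictates
    the root. As \<open>t \<le> 1\<close>, the copy shrunk towards \<open>a\<close> stays in
    \<Omega>; for \<open>c = 0\<close> it is the single point \<open>a\<close>.\<close>
  define t where "t = root DIM('a) (c / measure lebesgue \<Omega>)"
  have t: "0 \<le> t" "t \<le> 1" "t ^ DIM('a) = c / measure lebesgue \<Omega>"
    using assms pos by (auto simp: t_def)
  define \<omega> where "\<omega> = (\<lambda>x. t *\<^sub>R x + (1 - t) *\<^sub>R a) ` \<Omega>"
  have "\<omega> \<noteq> {}"
    using a by (auto simp: \<omega>_def)
  moreover have "compact \<omega>"
    unfolding \<omega>_def using \<open>compact \<Omega>\<close> by (intro compact_continuous_image continuous_intros)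
  moreover have "convex \<omega>"
    unfolding \<omega>_def using convex_affinity[OF \<open>convex \<Omega>\<close>, of "(1 - t) *\<^sub>R a" t] by (simp add: add.commute)
  moreover have "\<omega> \<subseteq> \<Omega>"
    using a \<open>convex \<Omega>\<close> t by (auto simp: \<omega>_def intro!: convexD)
  moreover have "measure lebesgue \<omega> = c"
    using measure_lebesgue_affine[of t "(1 - t) *\<^sub>R a" \<Omega>] t pos by (simp add: \<omega>_def)
  ultimately show ?thesis
    by (auto simp: convex_subbodies_def)
qed


section \<open>The Hausdorff measure on the unit sphere\<close>

lemma power_add_diff_le:
  fixes t :: real
  assumes "0 \<le> t" "t \<le> 1"
  shows "(1 + t) ^ n - (1 - t) ^ n \<le> 2 ^ n * real n * t"
proof -
  \<comment> \<open>Halving brings both bases into the unit interval, where a difference of powers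
    is at most \<open>n\<close> times the difference of the bases; this costs the factor
    \<open>2 ^ n\<close>.\<close>
  have "((1 + t) ^ n - (1 - t) ^ n) / 2 ^ n = ((1 + t) / 2) ^ n - ((1 - t) / 2) ^ n"
    by (simp only: power_divide flip: diff_divide_distrib)
  also have "\<dots> \<le> norm (((1 + t) / 2) ^ n - ((1 - t) / 2) ^ n)"
    by (simp only: real_norm_def abs_ge_self)
  also have "\<dots> \<le> n * norm ((1 + t) / 2 - (1 - t) / 2)"
    using assms by (intro norm_power_diff) auto
  also have "(1 + t) / 2 - (1 - t) / 2 = t"
    by (simp add: field_simps)
  finally have "((1 + t) ^ n - (1 - t) ^ n) / 2 ^ n \<le> n * t"
    using assms by simp
  then show ?thesis
    by (simp add: field_simps)
qed

text \<open>
  Disjoint balls of radius \<open>t\<close> around the points fit into a spherical shell of thickness \<open>2 * t\<close>.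
\<close>

lemma card_separated_sphere:
  fixes P :: "'a::euclidean_space set" and t :: real
  assumes "0 < t" "t \<le> 1" "finite P" "P \<subseteq> sphere 0 1"
    and sep: "\<And>x y. x \<in> P \<Longrightarrow> y \<in> P \<Longrightarrow> x \<noteq> y \<Longrightarrow> 2 * t \<le> dist x y"
  shows "card P * t ^ (DIM('a) - 1) \<le> 2 ^ DIM('a) * real DIM('a)"
proof -
  let ?n = "DIM('a)"
  let ?w = "unit_ball_vol ?n"
  have fin: "emeasure lborel (ball x r) < top" for x :: 'a and r
    using emeasure_lborel_ball_finite[of x r] by simp
  have "disjoint_family_on (\<lambda>x. ball x t) P"
    unfolding disjoint_family_on_def
  proof (intro ballI impI)
    fix x y assume "x \<in> P" "y \<in> P" "x \<noteq> y"
    then show "ball x t \<inter> ball y t = {}"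
      using sep by (intro disjoint_ballI) force
  qed
  then have "measure lborel (\<Union>x\<in>P. ball x t) = (\<Sum>x\<in>P. measure lborel (ball x t))"
    using \<open>finite P\<close> by (intro measure_finite_Union) (auto simp: less_imp_neq[OF fin])
  also have "\<dots> = card P * (?w * t ^ ?n)"
    using \<open>0 < t\<close> by (simp add: content_ball)
  finally have "card P * (?w * t ^ ?n) = measure lborel (\<Union>x\<in>P. ball x t)" ..
  also have "\<dots> \<le> measure lborel (ball (0::'a) (1 + t) - ball 0 (1 - t))"
  proof (rule measure_mono_fmeasurable)
    show "(\<Union>x\<in>P. ball x t) \<subseteq> ball 0 (1 + t) - ball 0 (1 - t)"
    proof clarify
      fix x y assume "x \<in> P" "y \<in> ball x t"
      then have "norm x = 1" "norm (x - y) < t"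
        using assms by (auto simp: dist_norm)
      then show "y \<in> ball 0 (1 + t) - ball 0 (1 - t)"
        using norm_triangle_ineq3[of x y] by (auto simp: dist_norm)
    qed
    show "ball (0::'a) (1 + t) - ball 0 (1 - t) \<in> fmeasurable lborel"
      by (intro fmeasurable.Diff) (auto intro!: fmeasurableI simp: fin)
  qed (auto intro!: borel_open)
  also have "\<dots> = measure lborel (ball (0::'a) (1 + t)) - measure lborel (ball (0::'a) (1 - t))"
    using \<open>0 < t\<close>
    by (intro measure_Diff) (auto simp: less_imp_neq[OF fin])
  also have "\<dots> = ?w * ((1 + t) ^ ?n - (1 - t) ^ ?n)"
    using assms by (simp add: content_ball right_diff_distrib)
  also have "\<dots> \<le> ?w * (2 ^ ?n * real ?n * t)"
    using assms by (intro mult_left_mono power_add_diff_le) auto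
  \<comment> \<open>The shell has volume of order \<open>t\<close> and each ball of order
    \<open>t ^ DIM('a)\<close>; one factor \<open>t\<close> cancels, leaving the exponent
    \<open>DIM('a) - 1\<close> of the sphere.\<close>
  finally have "?w * t * (card P * t ^ (?n - 1)) \<le> ?w * t * (2 ^ ?n * real ?n)"
    by (simp add: power_eq_if[of t ?n] ac_simps)
  then show ?thesis
    using \<open>0 < t\<close> by (subst (asm) mult_le_cancel_left_pos) auto
qed

text \<open>A separated set of greatest cardinality, which exists by the packing bound, is a net: a
  point farther than \<open>2 * t\<close> from all its members could be added.\<close>

lemma finite_net_sphere:
  fixes t :: real
  assumes "0 < t" "t \<le> 1"
  obtains P :: "'a::euclidean_space set" where
    "finite P" "sphere 0 1 \<subseteq> (\<Union>x\<in>P. cball x (2 * t))"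
    "card P * t ^ (DIM('a) - 1) \<le> 2 ^ DIM('a) * real DIM('a)"
proof -
  define sep :: "'a set \<Rightarrow> bool" where "sep P \<longleftrightarrow> finite P \<and> P \<subseteq> sphere 0 1 \<and>
    (\<forall>x\<in>P. \<forall>y\<in>P. x \<noteq> y \<longrightarrow> 2 * t \<le> dist x y)" for P
  have card: "card P * t ^ (DIM('a) - 1) \<le> 2 ^ DIM('a) * real DIM('a)" if "sep P" for P
    using assms that unfolding sep_def by (intro card_separated_sphere) auto
  obtain N :: nat where N: "2 ^ DIM('a) * real DIM('a) / t ^ (DIM('a) - 1) < N"
    using reals_Archimedean2 by blast
  have "card P < Suc N" if "sep P" for P
  proof -
    have "card P \<le> 2 ^ DIM('a) * real DIM('a) / t ^ (DIM('a) - 1)"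
      using card[OF that] \<open>0 < t\<close> by (simp add: pos_le_divide_eq)
    with N show ?thesis by linarith
  qed
  moreover have "sep {}"
    by (simp add: sep_def)
  ultimately obtain P where P: "sep P" "\<And>Q. sep Q \<Longrightarrow> card Q \<le> card P"
    using ex_has_greatest_nat[of sep "{}" card "Suc N"] by blast
  have "\<exists>x\<in>P. dist x y \<le> 2 * t" if "y \<in> sphere 0 1" for y
  proof (rule ccontr)
    assume *: "\<not> ?thesis"
    then have "y \<notin> P"
      using \<open>0 < t\<close> by force
    have "sep (insert y P)"
      using P(1) * that by (force simp: sep_def dist_commute)
    from P(2)[OF this] show False
      using P(1) \<open>y \<notin> P\<close> by (simp add: sep_def)
  qed
  then show ?thesis
    using that[of P] P(1) card[OF P(1)] by (force simp: sep_def)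
qed

lemma hausdorff_outer_measure_sphere_finite:
  "hausdorff_outer_measure (DIM('a) - 1) (sphere (0::'a::euclidean_space) 1) < \<infinity>"
proof -
  let ?m = "DIM('a) - 1"
  let ?w = "unit_ball_vol (real ?m)"
  let ?c = "?w * 2 ^ ?m * (2 ^ DIM('a) * real DIM('a))"
  have "hausdorff_pre_measure ?m \<delta> (sphere (0::'a) 1) \<le> ennreal ?c" if "0 < \<delta>" for \<delta>
  proof -
    \<comment> \<open>Balls of radius \<open>2 * t\<close> have diameter \<open>4 * t\<close>,
      whence \<open>\<delta> / 4\<close>; the cap 1 meets the hypothesis of the packing bound. The
      resulting total does not depend on \<delta>.\<close>
    define t where "t = min 1 (\<delta> / 4)"
    have t: "0 < t" "t \<le> 1" "4 * t \<le> \<delta>"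
      using that by (auto simp: t_def)
    obtain P :: "'a set" where P: "finite P" "sphere 0 1 \<subseteq> (\<Union>x\<in>P. cball x (2 * t))"
      "card P * t ^ ?m \<le> 2 ^ DIM('a) * real DIM('a)"
      using finite_net_sphere[OF t(1,2)] by blast
    obtain f where f: "bij_betw f {..<card P} P"
      using \<open>finite P\<close> by (metis atLeast0LessThan ex_bij_betw_nat_finite)
    \<comment> \<open>Empty sets pad the cover to a sequence; their weight is 0 even in dimension
      one, where the exponent is 0.\<close>
    define C where "C i = (if i < card P then cball (f i) (2 * t) else {})" for i
    have "(\<Union>x\<in>P. cball x (2 * t)) \<subseteq> (\<Union>i. C i)"
    proof clarify
      fix x y assume "x \<in> P" "y \<in> cball x (2 * t)"
      moreover obtain i where "i < card P" "f i = x"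
        using bij_betw_imp_surj_on[OF f] \<open>x \<in> P\<close> by (metis imageE lessThan_iff)
      ultimately have "y \<in> C i"
        by (simp add: C_def)
      then show "y \<in> (\<Union>i. C i)" by blast
    qed
    then have "hausdorff_pre_measure ?m \<delta> (sphere (0::'a) 1) \<le> (\<Sum>i. hausdorff_weight ?m (C i))"
      using P t that by (intro hausdorff_pre_measure_le) (auto simp: C_def)
    also have "\<dots> = (\<Sum>i<card P. hausdorff_weight ?m (C i))"
      by (rule suminf_finite) (auto simp: C_def)
    also have "\<dots> = (\<Sum>i<card P. ennreal (?w * (2 * t) ^ ?m))"
      using t by (intro sum.cong) (auto simp: C_def hausdorff_weight_def)
    also have "\<dots> = ennreal (card P * (?w * (2 * t) ^ ?m))"
      using t by (simp add: ennreal_of_nat_eq_real_of_nat ennreal_mult)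
    also have "\<dots> = ennreal (?w * 2 ^ ?m * (card P * t ^ ?m))"
      by (simp add: power_mult_distrib ac_simps)
    also have "\<dots> \<le> ennreal ?c"
      using P(3) by (intro ennreal_leI mult_left_mono) auto
    finally show ?thesis .
  qed
  then have "hausdorff_outer_measure ?m (sphere (0::'a) 1) \<le> ennreal ?c"
    unfolding hausdorff_outer_measure_def by (intro SUP_least) auto
  then show ?thesis
    by (rule order.strict_trans1) simp
qed

section \<open>Positivity on relatively open subsets of the sphere\<close>

text \<open>
  About \<open>1 / r\<close> balls of radius \<open>2 * r\<close> cover the cone over a set of diameter less than \<open>r\<close>.
\<close>

lemma cone_cover:
  fixes C :: "'a::euclidean_space set"
  assumes "bounded C" "diameter C \<le> 1" "0 < \<eta>"
  defines "m \<equiv> DIM('a) - 1"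
  defines "\<kappa> \<equiv> 3 * unit_ball_vol DIM('a) * 2 ^ DIM('a) * 2 ^ m / unit_ball_vol m"
  obtains B where "B \<in> sets lborel"
    "\<And>t x. 0 \<le> t \<Longrightarrow> t \<le> 1 \<Longrightarrow> x \<in> C \<Longrightarrow> norm x = 1 \<Longrightarrow> t *\<^sub>R x \<in> B"
    "emeasure lborel B \<le> ennreal \<kappa> * hausdorff_weight m C + ennreal \<eta>"
proof (cases "C \<inter> sphere 0 1 = {}")
  case True
  then show ?thesis
    using that[of "{}"] by (auto simp: disjoint_iff)
next
  case False
  then obtain y where y: "y \<in> C" "norm y = 1"
    by auto
  let ?d = "diameter C"
  define k where "k = 3 * unit_ball_vol DIM('a) * 2 ^ DIM('a)"
  have "unit_ball_vol (real m) \<noteq> 0"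
    by (metis less_irrefl of_nat_0_le_iff unit_ball_vol_pos)
  have "0 \<le> ?d"
    using \<open>bounded C\<close> by (rule diameter_ge_0)
  \<comment> \<open>The diameter may be 0, so a slightly larger \<open>r\<close> takes its place,
    and the slack \<eta> absorbs the excess.\<close>
  have "((\<lambda>r. k * r ^ m) \<longlongrightarrow> k * ?d ^ m) (at_right ?d)"
    by (intro tendsto_intros)
  then have "\<forall>\<^sub>F r in at_right ?d. k * r ^ m < k * ?d ^ m + \<eta>"
    by (rule order_tendstoD(2)) (use \<open>0 < \<eta>\<close> in simp)
  moreover have "\<forall>\<^sub>F r in at_right ?d. r \<in> {?d<..<2}"
    using \<open>?d \<le> 1\<close> by (intro eventually_at_right_real) simp
  ultimately have "\<forall>\<^sub>F r in at_right ?d. k * r ^ m < k * ?d ^ m + \<eta> \<and> r \<in> {?d<..<2}"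
    by (rule eventually_conj)
  then obtain r where r: "k * r ^ m < k * ?d ^ m + \<eta>" "?d < r" "r < 2"
    using eventually_happens'[OF trivial_limit_at_right_real] by auto
  have "0 < r"
    using r \<open>0 \<le> ?d\<close> by simp
  define N where "N = nat \<lfloor>1 / r\<rfloor>"
  \<comment> \<open>Centres are spaced by \<open>r\<close> on the segment from 0 towards
    \<open>y\<close>; the point \<open>t *\<^sub>R x\<close> goes to the centre with index the floor
    of \<open>t / r\<close>.\<close>
  define B where "B = (\<Union>j\<in>{..N}. cball ((j * r) *\<^sub>R y) (2 * r))"
  show ?thesis
  proof (rule that[of B])
    show "B \<in> sets lborel"
      by (auto simp: B_def)
    fix t :: real and x assume t: "0 \<le> t" "t \<le> 1" and x: "x \<in> C" "norm x = 1"
    define j where "j = nat \<lfloor>t / r\<rfloor>"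
    have "j \<le> N"
      unfolding j_def N_def using t \<open>0 < r\<close> by (intro nat_mono floor_mono divide_right_mono) auto
    have "real j = of_int \<lfloor>t / r\<rfloor>"
      using t \<open>0 < r\<close> by (simp add: j_def)
    then have "real j \<le> t / r" "t / r \<le> real j + 1"
      by linarith+
    then have j: "j * r \<le> t" "t \<le> j * r + r"
      using \<open>0 < r\<close> by (simp_all add: field_simps)
    \<comment> \<open>Rounding \<open>t\<close> costs at most \<open>r\<close>, and replacing
      \<open>x\<close> by \<open>y\<close> costs at most the diameter, which is below
      \<open>r\<close>; hence the radius \<open>2 * r\<close>.\<close>
    have "t *\<^sub>R x - (j * r) *\<^sub>R y = (t - j * r) *\<^sub>R x + (j * r) *\<^sub>R (x - y)"
      by (simp add: algebra_simps)
    then have "norm (t *\<^sub>R x - (j * r) *\<^sub>R y) \<le> (t - j * r) + (j * r) * norm (x - y)"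
      using norm_triangle_ineq[of "(t - j * r) *\<^sub>R x" "(j * r) *\<^sub>R (x - y)"] j x \<open>0 < r\<close> by simp
    also have "(j * r) * norm (x - y) \<le> 1 * ?d"
      using diameter_bounded_bound[OF \<open>bounded C\<close> x(1) y(1)] j t
      by (intro mult_mono) (auto simp: dist_norm)
    finally have "norm (t *\<^sub>R x - (j * r) *\<^sub>R y) \<le> 2 * r"
      using j r by simp
    then show "t *\<^sub>R x \<in> B"
      using \<open>j \<le> N\<close> by (auto simp: B_def dist_norm norm_minus_commute)
  next
    have "real N \<le> 1 / r"
      using \<open>0 < r\<close> by (simp add: N_def)
    \<comment> \<open>Since \<open>r < 2\<close>, the additional ball is accounted for by
      \<open>1 \<le> 2 / r\<close>.\<close>
    then have N: "real (Suc N) \<le> 3 / r"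
      using r \<open>0 < r\<close> by (simp add: field_simps)
    have "emeasure lborel B \<le> (\<Sum>j\<le>N. emeasure lborel (cball ((j * r) *\<^sub>R y) (2 * r)))"
      unfolding B_def by (rule emeasure_subadditive_finite) auto
    also have "\<dots> = ennreal (Suc N * (unit_ball_vol DIM('a) * (2 * r) ^ DIM('a)))"
      using \<open>0 < r\<close> by (simp add: emeasure_cball ennreal_of_nat_eq_real_of_nat ennreal_mult del: of_nat_Suc)
    also have "\<dots> \<le> ennreal (3 / r * (unit_ball_vol DIM('a) * (2 * r) ^ DIM('a)))"
      using N \<open>0 < r\<close> by (intro ennreal_leI mult_right_mono) auto
    also have "3 / r * (unit_ball_vol DIM('a) * (2 * r) ^ DIM('a)) = k * r ^ m"
      using \<open>0 < r\<close> by (simp add: k_def m_def power_mult_distrib power_eq_if[of r "DIM('a)"])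
    also have "ennreal (k * r ^ m) \<le> ennreal (k * ?d ^ m + \<eta>)"
      using r by (intro ennreal_leI) simp
    also have "\<dots> = ennreal (k * ?d ^ m) + ennreal \<eta>"
      using \<open>0 \<le> ?d\<close> \<open>0 < \<eta>\<close> by (simp add: k_def)
    \<comment> \<open>The factor \<open>2 ^ m / unit_ball_vol m\<close> in \<kappa> undoes the
      normalisation of the weight.\<close>
    also have "k * ?d ^ m = \<kappa> * (unit_ball_vol m * (?d / 2) ^ m)"
      using \<open>unit_ball_vol (real m) \<noteq> 0\<close> by (simp add: k_def \<kappa>_def power_divide)
    also have "ennreal \<dots> = ennreal \<kappa> * hausdorff_weight m C"
      using y \<open>0 \<le> ?d\<close> by (subst ennreal_mult) (auto simp: \<kappa>_def hausdorff_weight_def)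
    finally show "emeasure lborel B \<le> ennreal \<kappa> * hausdorff_weight m C + ennreal \<eta>" .
  qed
qed

text \<open>The pre-measure at the single scale 1 suffices: were it 0, covers of arbitrarily small
  total weight would exist, and the cones over their members would cover a non-empty open set with
  arbitrarily small volume.\<close>

lemma hausdorff_outer_measure_open_sphere_pos:
  fixes T :: "'a::euclidean_space set"
  assumes "open T" "x0 \<in> T" "norm x0 = 1"
  shows "0 < hausdorff_outer_measure (DIM('a) - 1) (sphere 0 1 \<inter> T)"
proof (rule ccontr)
  let ?m = "DIM('a) - 1"
  let ?A = "sphere 0 1 \<inter> T"
  assume "\<not> ?thesis"
  then have "hausdorff_pre_measure ?m 1 ?A = 0"
    using hausdorff_pre_measure_le_outer[of 1 ?m ?A] by simp
  \<comment> \<open>This is the open cone over \<open>?A\<close> without its apex, where radial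
    projection is undefined.\<close>
  define U where "U = (ball 0 1 - {0}) \<inter> (\<lambda>z. z /\<^sub>R norm z) -` T"
  have "open U"
    unfolding U_def using \<open>open T\<close>
    by (intro continuous_open_preimage continuous_intros) auto
  moreover have "(1/2) *\<^sub>R x0 \<in> U"
    using assms by (auto simp: U_def)
  ultimately have "\<not> negligible U"
    using open_not_negligible by blast
  define \<kappa> where "\<kappa> = 3 * unit_ball_vol DIM('a) * 2 ^ DIM('a) * 2 ^ ?m / unit_ball_vol ?m"
  have "0 \<le> \<kappa>"
    by (simp add: \<kappa>_def)
  have "emeasure lborel U \<le> 0"
  proof (rule ennreal_le_epsilon)
    fix \<epsilon> :: real assume "0 < \<epsilon>"
    \<comment> \<open>The weights contribute at most \<open>\<kappa> * e\<close> and the slacks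
      \<open>e * (1/2) ^ Suc i\<close> sum to \<open>e\<close>, which makes \<epsilon> in
      total.\<close>
    define e where "e = \<epsilon> / (\<kappa> + 1)"
    have "0 < e"
      using \<open>0 < \<epsilon>\<close> \<open>0 \<le> \<kappa>\<close> by (simp add: e_def)
    then have "hausdorff_pre_measure ?m 1 ?A < ennreal e"
      using \<open>hausdorff_pre_measure ?m 1 ?A = 0\<close> by simp
    then obtain C :: "nat \<Rightarrow> 'a set" where C: "?A \<subseteq> (\<Union>i. C i)"
      "\<And>i. bounded (C i)" "\<And>i. diameter (C i) \<le> 1"
      "(\<Sum>i. hausdorff_weight ?m (C i)) < ennreal e"
      by (auto simp: hausdorff_pre_measure_def INF_less_iff)
    have "\<exists>B. B \<in> sets lborel \<and>
        (\<forall>t x. 0 \<le> t \<and> t \<le> 1 \<and> x \<in> C i \<and> norm x = 1 \<longrightarrow> t *\<^sub>R x \<in> B) \<and>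
        emeasure lborel B \<le> ennreal \<kappa> * hausdorff_weight ?m (C i) + ennreal (e * (1/2) ^ Suc i)" for i
      using cone_cover[OF C(2,3)[of i], of "e * (1/2) ^ Suc i"] \<open>0 < e\<close> unfolding \<kappa>_def
      by (metis mult_pos_pos zero_less_power half_gt_zero zero_less_one)
    then obtain B where B: "\<And>i. B i \<in> sets lborel"
      "\<And>i t x. 0 \<le> t \<Longrightarrow> t \<le> 1 \<Longrightarrow> x \<in> C i \<Longrightarrow> norm x = 1 \<Longrightarrow> t *\<^sub>R x \<in> B i"
      "\<And>i. emeasure lborel (B i)
        \<le> ennreal \<kappa> * hausdorff_weight ?m (C i) + ennreal (e * (1/2) ^ Suc i)"
      by metis
    have "U \<subseteq> (\<Union>i. B i)"
    proof
      fix z assume z: "z \<in> U"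
      define x where "x = z /\<^sub>R norm z"
      have x: "norm x = 1" "x \<in> T" "norm z *\<^sub>R x = z" "norm z \<le> 1"
        using z by (auto simp: U_def x_def)
      then obtain i where "x \<in> C i"
        using C(1) by auto
      then have "norm z *\<^sub>R x \<in> B i"
        using x by (intro B) auto
      then show "z \<in> (\<Union>i. B i)"
        using x by auto
    qed
    then have "emeasure lborel U \<le> emeasure lborel (\<Union>i. B i)"
      using B(1) by (intro emeasure_mono) auto
    also have "\<dots> \<le> (\<Sum>i. emeasure lborel (B i))"
      using B(1) by (intro emeasure_subadditive_countably) auto
    also have "\<dots> \<le> (\<Sum>i. ennreal \<kappa> * hausdorff_weight ?m (C i) + ennreal (e * (1/2) ^ Suc i))"
      by (intro suminf_le B) auto
    also have "\<dots> = ennreal \<kappa> * (\<Sum>i. hausdorff_weight ?m (C i)) + (\<Sum>i. ennreal (e * (1/2) ^ Suc i))"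
      by (subst suminf_add[symmetric]) auto
    also have "(\<Sum>i. ennreal (e * (1/2) ^ Suc i)) = ennreal e"
      using sums_mult[OF power_half_series, of e] \<open>0 < e\<close> by (intro suminf_ennreal_eq) auto
    also have "ennreal \<kappa> * (\<Sum>i. hausdorff_weight ?m (C i)) + ennreal e \<le> ennreal \<kappa> * ennreal e + ennreal e"
      using C(4) by (intro add_right_mono mult_left_mono) auto
    also have "\<dots> = ennreal ((\<kappa> + 1) * e)"
      using \<open>0 \<le> \<kappa>\<close> \<open>0 < e\<close> by (simp add: ennreal_mult distrib_right)
    also have "(\<kappa> + 1) * e = \<epsilon>"
      using \<open>0 \<le> \<kappa>\<close> by (simp add: e_def)
    finally show "emeasure lborel U \<le> 0 + ennreal \<epsilon>"
      by simp
  qed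
  then have "U \<in> null_sets lborel"
    using \<open>open U\<close> by (auto intro: null_setsI)
  then show False
    using \<open>\<not> negligible U\<close> by (simp add: negligible_iff_null_sets null_sets_completionI)
qed

section \<open>Consequences for real-valued measure and integration\<close>

lemma emeasure_hausdorff_sphere_finite:
  "emeasure (hausdorff_measure (DIM('a) - 1)) (sphere (0::'a::euclidean_space) 1) < \<infinity>"
  using hausdorff_outer_measure_sphere_finite by (simp add: emeasure_hausdorff_measure)

lemma measure_hausdorff_open_sphere_pos:
  fixes T :: "'a::euclidean_space set"
  assumes "open T" "x0 \<in> T" "norm x0 = 1"
  shows "0 < measure (hausdorff_measure (DIM('a) - 1)) (sphere 0 1 \<inter> T)"
proof -
  let ?\<mu> = "hausdorff_measure (DIM('a) - 1) :: 'a measure"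
  have sets: "sphere 0 1 \<inter> T \<in> sets ?\<mu>"
    using \<open>open T\<close> by simp
  then have "0 < emeasure ?\<mu> (sphere 0 1 \<inter> T)"
    using hausdorff_outer_measure_open_sphere_pos[OF assms] by (simp add: emeasure_hausdorff_measure)
  moreover have "emeasure ?\<mu> (sphere 0 1 \<inter> T) \<le> emeasure ?\<mu> (sphere 0 1)"
    by (intro emeasure_mono) auto
  \<comment> \<open>Positivity of \<open>emeasure\<close> alone is not enough, because
    \<open>measure\<close> sends an infinite value to 0.\<close>
  then have "emeasure ?\<mu> (sphere 0 1 \<inter> T) < top"
    using emeasure_hausdorff_sphere_finite[where 'a='a] by (simp add: order.strict_trans1)
  ultimately show ?thesis
    by (simp add: measure_def enn2real_positive_iff)
qed

lemma set_integrable_hausdorff_sphere: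
  fixes f :: "'a::euclidean_space \<Rightarrow> real"
  assumes "continuous_on UNIV f"
  shows "set_integrable (hausdorff_measure (DIM('a) - 1)) (sphere 0 1) f"
proof -
  have "compact (f ` sphere 0 1)"
    using assms by (intro compact_continuous_image) (auto intro: continuous_on_subset)
  then obtain b where "\<forall>y\<in>f ` sphere 0 1. norm y \<le> b"
    using bounded_iff compact_imp_bounded by blast
  then have "norm (f x) \<le> b" if "x \<in> sphere 0 1" for x
    using that by blast
  moreover have "f \<in> borel_measurable (hausdorff_measure (DIM('a) - 1))"
    using borel_measurable_continuous_onI[OF assms]
    by (simp add: measurable_cong_sets[OF sets_hausdorff_measure refl])
  ultimately show ?thesis
    unfolding set_integrable_def
    using emeasure_hausdorff_sphere_finite[where 'a='a]
    by (intro integrableI_bounded_set_indicator[where B=b]) auto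
qed


section \<open>The functionals and their convergence\<close>

text \<open>The difference can vanish, and at base 0 a power is continuous only for a positive
  exponent; hence \<open>0 < p\<close>.\<close>

lemma continuous_on_support_fun_diff_powr:
  fixes \<Omega> \<omega> :: "'a::euclidean_space set"
  assumes "compact \<Omega>" "\<Omega> \<noteq> {}" "compact \<omega>" "\<omega> \<noteq> {}" "0 < p"
  shows "continuous_on A (\<lambda>\<theta>. \<bar>support_fun \<Omega> \<theta> - support_fun \<omega> \<theta>\<bar> powr p)"
  using assms
  by (intro continuous_on_powr' continuous_intros continuous_on_support_fun)
     (auto intro: compact_imp_bounded)

section \<open>Bounds and continuity for fixed exponent\<close>

lemma J_fun_nonneg: "0 \<le> J_fun \<Omega> p \<omega>"
  by (simp add: J_fun_def)

lemma J_fun_le: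
  fixes \<Omega> \<omega> :: "'a::euclidean_space set"
  assumes "compact \<Omega>" "\<Omega> \<noteq> {}" "compact \<omega>" "\<omega> \<noteq> {}" "0 < p"
    and b: "\<And>\<theta>. norm \<theta> = 1 \<Longrightarrow> \<bar>support_fun \<Omega> \<theta> - support_fun \<omega> \<theta>\<bar> \<le> b" and "0 \<le> b"
  shows "J_fun \<Omega> p \<omega> \<le> b * measure (hausdorff_measure (DIM('a) - 1)) (sphere (0::'a) 1) powr (1 / p)"
proof -
  let ?\<mu> = "hausdorff_measure (DIM('a) - 1) :: 'a measure"
  let ?f = "\<lambda>\<theta>. \<bar>support_fun \<Omega> \<theta> - support_fun \<omega> \<theta>\<bar> powr p"
  have "(LINT \<theta>:sphere 0 1|?\<mu>. ?f \<theta>) \<le> (LINT \<theta>:sphere 0 1|?\<mu>. b powr p)"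
    using assms
    by (intro set_integral_mono set_integrable_hausdorff_sphere continuous_on_support_fun_diff_powr
        powr_mono2) auto
  also have "\<dots> = b powr p * measure ?\<mu> (sphere 0 1)"
    by (simp add: set_lebesgue_integral_def)
  finally have "(LINT \<theta>:sphere 0 1|?\<mu>. ?f \<theta>) powr (1 / p)
      \<le> (b powr p * measure ?\<mu> (sphere 0 1)) powr (1 / p)"
    using \<open>0 < p\<close> by (intro powr_mono2) (auto simp: set_lebesgue_integral_def intro!: integral_nonneg_AE)
  also have "\<dots> = b * measure ?\<mu> (sphere 0 1) powr (1 / p)"
    using \<open>0 < p\<close> \<open>0 \<le> b\<close> by (simp add: powr_mult powr_powr)
  finally show ?thesis
    by (simp add: J_fun_def)
qed

text \<open>Markov's inequality in \<open>p\<close>-th root form: the integral is restricted to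
  \<open>A\<close>, where the integrand is at least \<open>b powr p\<close>. For \<open>A\<close> of
  positive measure the factor next to \<open>b\<close> tends to 1 as \<open>p\<close> grows.\<close>

lemma J_fun_ge:
  fixes \<Omega> \<omega> :: "'a::euclidean_space set"
  assumes "compact \<Omega>" "\<Omega> \<noteq> {}" "compact \<omega>" "\<omega> \<noteq> {}" "0 < p"
    and A: "A \<in> sets borel" "A \<subseteq> sphere 0 1"
    and b: "\<And>\<theta>. \<theta> \<in> A \<Longrightarrow> b \<le> \<bar>support_fun \<Omega> \<theta> - support_fun \<omega> \<theta>\<bar>" and "0 \<le> b"
  shows "b * measure (hausdorff_measure (DIM('a) - 1)) A powr (1 / p) \<le> J_fun \<Omega> p \<omega>"
proof -
  let ?\<mu> = "hausdorff_measure (DIM('a) - 1) :: 'a measure"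
  let ?f = "\<lambda>\<theta>. \<bar>support_fun \<Omega> \<theta> - support_fun \<omega> \<theta>\<bar> powr p"
  have int: "set_integrable ?\<mu> (sphere 0 1) ?f"
    using assms by (intro set_integrable_hausdorff_sphere continuous_on_support_fun_diff_powr)
  have "emeasure ?\<mu> A \<le> emeasure ?\<mu> (sphere 0 1)"
    using A by (intro emeasure_mono) auto
  then have "emeasure ?\<mu> A < \<infinity>"
    using emeasure_hausdorff_sphere_finite[where 'a='a] by (rule order.strict_trans1)
  have "b powr p * measure ?\<mu> A = (LINT \<theta>:A|?\<mu>. b powr p)"
    using A by (simp add: set_lebesgue_integral_def)
  also have "\<dots> \<le> (LINT \<theta>:sphere 0 1|?\<mu>. ?f \<theta>)"
    unfolding set_lebesgue_integral_def
  proof (rule integral_mono)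
    show "integrable ?\<mu> (\<lambda>\<theta>. indicator A \<theta> *\<^sub>R b powr p)"
      using A \<open>emeasure ?\<mu> A < \<infinity>\<close> by simp
    show "integrable ?\<mu> (\<lambda>\<theta>. indicator (sphere 0 1) \<theta> *\<^sub>R ?f \<theta>)"
      using int by (simp add: set_integrable_def)
    show "indicator A \<theta> *\<^sub>R b powr p \<le> indicator (sphere 0 1) \<theta> *\<^sub>R ?f \<theta>" for \<theta>
      using A b \<open>0 \<le> b\<close> \<open>0 < p\<close> by (auto simp: indicator_def intro!: powr_mono2)
  qed
  finally have "(b powr p * measure ?\<mu> A) powr (1 / p) \<le> (LINT \<theta>:sphere 0 1|?\<mu>. ?f \<theta>) powr (1 / p)"
    using \<open>0 < p\<close> by (intro powr_mono2) auto
  moreover have "(b powr p * measure ?\<mu> A) powr (1 / p) = b * measure ?\<mu> A powr (1 / p)"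
    using \<open>0 < p\<close> \<open>0 \<le> b\<close> by (simp add: powr_mult powr_powr)
  ultimately show ?thesis
    by (simp add: J_fun_def)
qed

lemma convex_subbodiesD:
  assumes "\<omega> \<in> convex_subbodies \<Omega> c"
  shows "compact \<omega>" "convex \<omega>" "\<omega> \<noteq> {}" "\<omega> \<subseteq> \<Omega>" "\<Omega> \<noteq> {}"
  using assms by (auto simp: convex_subbodies_def)

lemma J_inf_nonneg:
  assumes "compact \<Omega>" "\<omega> \<in> convex_subbodies \<Omega> c"
  shows "0 \<le> J_inf \<Omega> \<omega>"
  using assms convex_subbodiesD[OF assms(2)]
  by (simp add: J_inf_def hausdorff_dist_nonneg compact_imp_bounded)

lemma abs_support_fun_diff_le_J_inf:
  fixes \<Omega> :: "'a::euclidean_space set"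
  assumes "compact \<Omega>" "\<omega> \<in> convex_subbodies \<Omega> c" "norm \<theta> = 1"
  shows "\<bar>support_fun \<Omega> \<theta> - support_fun \<omega> \<theta>\<bar> \<le> J_inf \<Omega> \<omega>"
  using abs_support_fun_diff_le[of \<Omega> \<omega> \<theta>] assms convex_subbodiesD[OF assms(2)]
  by (simp add: J_inf_def hausdorff_dist_commute)

text \<open>A bound common to all competitors, which supplies the dominating function for the
  continuity of \<open>J_fun\<close>.\<close>

lemma J_inf_le_diameter:
  fixes \<Omega> :: "'a::euclidean_space set"
  assumes "compact \<Omega>" "\<omega> \<in> convex_subbodies \<Omega> c"
  shows "J_inf \<Omega> \<omega> \<le> diameter \<Omega>"
proof -
  note \<omega> = convex_subbodiesD[OF assms(2)]
  have bd: "bounded \<Omega>"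
    using \<open>compact \<Omega>\<close> by (rule compact_imp_bounded)
  show ?thesis
    unfolding J_inf_def
  proof (rule hausdorff_dist_le)
    fix x assume "x \<in> \<omega>"
    then show "infdist x \<Omega> \<le> diameter \<Omega>"
      using \<omega> diameter_ge_0[OF bd] by (auto simp: infdist_zero)
  next
    fix y assume "y \<in> \<Omega>"
    obtain z where "z \<in> \<omega>"
      using \<omega> by blast
    then have "dist y z \<le> diameter \<Omega>"
      using \<omega> \<open>y \<in> \<Omega>\<close> by (intro diameter_bounded_bound bd) auto
    with \<open>z \<in> \<omega>\<close> show "infdist y \<omega> \<le> diameter \<Omega>"
      by (rule infdist_le2)
  qed (use \<omega> in auto)
qed

lemma tendsto_support_fun:
  fixes \<omega> :: "'a::euclidean_space set"
  assumes "\<And>k. compact (u k)" "\<And>k. u k \<noteq> {}" "compact \<omega>" "\<omega> \<noteq> {}"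
    and lim: "(\<lambda>k. hausdorff_dist (u k) \<omega>) \<longlonglongrightarrow> 0" and "norm \<theta> = 1"
  shows "(\<lambda>k. support_fun (u k) \<theta>) \<longlonglongrightarrow> support_fun \<omega> \<theta>"
proof (rule LIM_zero_cancel, rule Lim_null_comparison[OF _ lim], rule always_eventually, rule allI)
  show "norm (support_fun (u k) \<theta> - support_fun \<omega> \<theta>) \<le> hausdorff_dist (u k) \<omega>" for k
    using assms by (simp add: abs_support_fun_diff_le)
qed

lemma J_fun_continuous:
  fixes \<Omega> :: "'a::euclidean_space set"
  assumes "compact \<Omega>" "0 < p" and u: "\<And>k. u k \<in> convex_subbodies \<Omega> c"
    and \<omega>: "\<omega> \<in> convex_subbodies \<Omega> c"
    and lim: "(\<lambda>k. hausdorff_dist (u k) \<omega>) \<longlonglongrightarrow> 0"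
  shows "(\<lambda>k. J_fun \<Omega> p (u k)) \<longlonglongrightarrow> J_fun \<Omega> p \<omega>"
proof -
  let ?\<mu> = "hausdorff_measure (DIM('a) - 1) :: 'a measure"
  let ?f = "\<lambda>\<omega> \<theta>. \<bar>support_fun \<Omega> \<theta> - support_fun \<omega> \<theta>\<bar> powr p"
  note u' = convex_subbodiesD[OF u] and \<omega>' = convex_subbodiesD[OF \<omega>]
  have int: "set_integrable ?\<mu> (sphere 0 1) (?f \<tau>)" if "\<tau> \<in> convex_subbodies \<Omega> c" for \<tau>
    using assms convex_subbodiesD[OF that]
    by (intro set_integrable_hausdorff_sphere continuous_on_support_fun_diff_powr)
  have "(\<lambda>k. LINT \<theta>:sphere 0 1|?\<mu>. ?f (u k) \<theta>) \<longlonglongrightarrow> (LINT \<theta>:sphere 0 1|?\<mu>. ?f \<omega> \<theta>)"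
    unfolding set_lebesgue_integral_def
  proof (rule integral_dominated_convergence)
    show "integrable ?\<mu> (\<lambda>\<theta>. indicator (sphere 0 1) \<theta> *\<^sub>R diameter \<Omega> powr p)"
      using set_integrable_hausdorff_sphere[where 'a='a, of "\<lambda>_. diameter \<Omega> powr p"]
      by (simp add: set_integrable_def)
    show "AE \<theta> in ?\<mu>. (\<lambda>k. indicator (sphere 0 1) \<theta> *\<^sub>R ?f (u k) \<theta>)
        \<longlonglongrightarrow> indicator (sphere 0 1) \<theta> *\<^sub>R ?f \<omega> \<theta>"
    proof (rule AE_I2)
      fix \<theta> :: 'a
      show "(\<lambda>k. indicator (sphere 0 1) \<theta> *\<^sub>R ?f (u k) \<theta>)
          \<longlonglongrightarrow> indicator (sphere 0 1) \<theta> *\<^sub>R ?f \<omega> \<theta>"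
      proof (cases "norm \<theta> = 1")
        case True
        have "(\<lambda>k. support_fun (u k) \<theta>) \<longlonglongrightarrow> support_fun \<omega> \<theta>"
          by (rule tendsto_support_fun) (use u' \<omega>' lim True in auto)
        then show ?thesis
          using \<open>0 < p\<close> by (intro tendsto_scaleR tendsto_powr' tendsto_intros) auto
      qed (simp add: indicator_def)
    qed
    show "AE \<theta> in ?\<mu>. norm (indicator (sphere 0 1) \<theta> *\<^sub>R ?f (u k) \<theta>)
        \<le> indicator (sphere 0 1) \<theta> *\<^sub>R diameter \<Omega> powr p" for k
    proof (rule AE_I2)
      fix \<theta> :: 'a
      have "?f (u k) \<theta> \<le> diameter \<Omega> powr p" if "norm \<theta> = 1"
        using order_trans[OF abs_support_fun_diff_le_J_inf[OF _ u that] J_inf_le_diameter[OF _ u]]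
          \<open>compact \<Omega>\<close> \<open>0 < p\<close> by (intro powr_mono2) auto
      then show "norm (indicator (sphere 0 1) \<theta> *\<^sub>R ?f (u k) \<theta>)
          \<le> indicator (sphere 0 1) \<theta> *\<^sub>R diameter \<Omega> powr p"
        by (simp add: indicator_def)
    qed
  qed (use int[OF u] int[OF \<omega>] in \<open>auto simp: set_integrable_def\<close>)
  \<comment> \<open>The limit integral may be 0, as for \<omega> equal to \<Omega>; taking the root
    then relies on non-negative integrals and a positive exponent.\<close>
  then show ?thesis
    unfolding J_fun_def using \<open>0 < p\<close>
    by (intro tendsto_powr' tendsto_const)
       (auto simp: set_lebesgue_integral_def intro!: integral_nonneg_AE)
qed

section \<open>Behaviour as the exponent tends to infinity\<close>

lemma tendsto_powr_inverse_at_top: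
  fixes b :: real
  assumes "0 < b"
  shows "((\<lambda>p. a * b powr (1 / p)) \<longlongrightarrow> a) at_top"
proof -
  have "((\<lambda>p::real. 1 / p) \<longlongrightarrow> 0) at_top"
    by (intro real_tendsto_divide_at_top[OF tendsto_const] filterlim_ident)
  \<comment> \<open>For base 0 the limit would be 0 instead of \<open>a\<close>; this is why the
    sets of directions must have positive measure.\<close>
  then have "((\<lambda>p. a * b powr (1 / p)) \<longlongrightarrow> a * b powr 0) at_top"
    using assms by (intro tendsto_intros) auto
  then show ?thesis
    using assms by simp
qed

text \<open>One estimate for three purposes: the constant recovery sequence, the upper bound for the
  infima, and the comparison of minimisers with a fixed competitor.\<close>

lemma J_fun_eventually_less:
  fixes \<Omega> :: "'a::euclidean_space set"
  assumes "compact \<Omega>" "\<omega> \<in> convex_subbodies \<Omega> c" "J_inf \<Omega> \<omega> < a"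
  shows "\<forall>\<^sub>F p in at_top. J_fun \<Omega> p \<omega> < a"
proof -
  let ?S = "measure (hausdorff_measure (DIM('a) - 1)) (sphere (0::'a) 1)"
  obtain x0 :: 'a where "norm x0 = 1"
    using vector_choose_size[of 1] by auto
  then have "0 < ?S"
    using measure_hausdorff_open_sphere_pos[of UNIV x0] by simp
  from order_tendstoD(2)[OF tendsto_powr_inverse_at_top[OF this] assms(3)] eventually_gt_at_top[of 0]
  show ?thesis
  proof eventually_elim
    case (elim p)
    have "J_fun \<Omega> p \<omega> \<le> J_inf \<Omega> \<omega> * ?S powr (1 / p)"
      using assms convex_subbodiesD[OF assms(2)] elim
      by (intro J_fun_le abs_support_fun_diff_le_J_inf J_inf_nonneg) auto
    with elim show ?case by simp
  qed
qed

text \<open>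
  The maximum is almost attained on a relatively open subset of the sphere, which has positive
  Hausdorff measure.
\<close>

lemma J_fun_eventually_greater:
  fixes \<Omega> :: "'a::euclidean_space set" and p :: "nat \<Rightarrow> real"
  assumes "compact \<Omega>" and u: "\<And>k. u k \<in> convex_subbodies \<Omega> c"
    and \<omega>: "\<omega> \<in> convex_subbodies \<Omega> c"
    and lim: "(\<lambda>k. hausdorff_dist (u k) \<omega>) \<longlonglongrightarrow> 0"
    and p: "filterlim p at_top sequentially" and "a < J_inf \<Omega> \<omega>"
  shows "\<forall>\<^sub>F k in sequentially. a < J_fun \<Omega> (p k) (u k)"
proof (cases "a < 0")
  \<comment> \<open>Settling negative \<open>a\<close> first makes \<open>b\<close> non-negative
    below, as \<open>J_fun_ge\<close> demands.\<close>
  case True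
  then show ?thesis
    using order.strict_trans2[OF _ J_fun_nonneg] by (intro always_eventually) blast
next
  case False
  note u' = convex_subbodiesD[OF u] and \<omega>' = convex_subbodiesD[OF \<omega>]
  let ?g = "\<lambda>\<theta>. \<bar>support_fun \<Omega> \<theta> - support_fun \<omega> \<theta>\<bar>"
  \<comment> \<open>Two gaps are needed: the one between \<open>b\<close> and \<open>b'\<close>
    absorbs the Hausdorff distance from \<open>u k\<close> to \<omega>, the one between
    \<open>a\<close> and \<open>b\<close> absorbs the factor
    \<open>?m powr (1 / p k)\<close>.\<close>
  obtain b' where b': "a < b'" "b' < J_inf \<Omega> \<omega>"
    using dense[OF assms(6)] by blast
  obtain b where b: "a < b" "b < b'"
    using dense[OF b'(1)] by blast
  obtain \<theta>0 where \<theta>0: "norm \<theta>0 = 1" "J_inf \<Omega> \<omega> = ?g \<theta>0"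
    using hausdorff_dist_eq_support_fun_diff[of \<omega> \<Omega>] \<open>compact \<Omega>\<close> \<omega>' by (metis J_inf_def)
  define T where "T = {\<theta>. b' < ?g \<theta>}"
  have "open T"
    unfolding T_def using \<open>compact \<Omega>\<close> \<omega>'
    by (intro open_Collect_less continuous_intros continuous_on_support_fun)
       (auto intro: compact_imp_bounded)
  let ?m = "measure (hausdorff_measure (DIM('a) - 1)) (sphere 0 1 \<inter> T)"
  have "0 < ?m"
    using \<open>open T\<close> \<theta>0 b' by (intro measure_hausdorff_open_sphere_pos[of T \<theta>0]) (auto simp: T_def)
  then have "((\<lambda>k. b * ?m powr (1 / p k)) \<longlongrightarrow> b) sequentially"
    using p by (rule filterlim_compose[OF tendsto_powr_inverse_at_top])
  then have "\<forall>\<^sub>F k in sequentially. a < b * ?m powr (1 / p k)"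
    using b(1) by (rule order_tendstoD)
  moreover have "\<forall>\<^sub>F k in sequentially. hausdorff_dist (u k) \<omega> < b' - b"
    using lim b by (intro order_tendstoD(2)) auto
  moreover have "\<forall>\<^sub>F k in sequentially. 0 < p k"
    using p by (simp add: filterlim_at_top_dense)
  ultimately show ?thesis
  proof eventually_elim
    case (elim k)
    have "b \<le> \<bar>support_fun \<Omega> \<theta> - support_fun (u k) \<theta>\<bar>" if "\<theta> \<in> sphere 0 1 \<inter> T" for \<theta>
    proof -
      have "\<bar>support_fun (u k) \<theta> - support_fun \<omega> \<theta>\<bar> \<le> hausdorff_dist (u k) \<omega>"
        using u' \<omega>' that by (intro abs_support_fun_diff_le) auto
      moreover have "b' < ?g \<theta>"
        using that by (simp add: T_def)
      ultimately show ?thesis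
        using elim by linarith
    qed
    then have "b * ?m powr (1 / p k) \<le> J_fun \<Omega> (p k) (u k)"
      using \<open>compact \<Omega>\<close> u' elim \<open>open T\<close> b False by (intro J_fun_ge) auto
    with elim show ?case by simp
  qed
qed

lemma Gamma_converges_J:
  fixes \<Omega> :: "'a::euclidean_space set"
  assumes "compact \<Omega>"
  shows "Gamma_converges (convex_subbodies \<Omega> c) hausdorff_dist (J_fun \<Omega>) (J_inf \<Omega>)"
  unfolding Gamma_converges_def
proof (intro allI impI conjI ballI)
  fix p :: "nat \<Rightarrow> real" and \<omega> u
  assume p: "(\<forall>k. 1 \<le> p k) \<and> filterlim p at_top sequentially"
    and \<omega>: "\<omega> \<in> convex_subbodies \<Omega> c"
    and u: "(\<forall>k. u k \<in> convex_subbodies \<Omega> c) \<and> (\<lambda>k. hausdorff_dist (u k) \<omega>) \<longlonglongrightarrow> 0"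
  show "ereal (J_inf \<Omega> \<omega>) \<le> liminf (\<lambda>k. ereal (J_fun \<Omega> (p k) (u k)))"
    \<comment> \<open>Only real test values carry content: minus infinity is trivial and plus
      infinity is excluded.\<close>
    unfolding le_Liminf_iff
  proof (intro allI impI)
    fix y assume y: "y < ereal (J_inf \<Omega> \<omega>)"
    show "\<forall>\<^sub>F k in sequentially. y < ereal (J_fun \<Omega> (p k) (u k))"
    proof (cases y)
      case (real a)
      then show ?thesis
        using J_fun_eventually_greater[OF \<open>compact \<Omega>\<close> _ \<omega>, of u p a] p u y by simp
    qed (use y in auto)
  qed
next
  fix p :: "nat \<Rightarrow> real" and \<omega>
  assume p: "(\<forall>k. 1 \<le> p k) \<and> filterlim p at_top sequentially"
    and \<omega>: "\<omega> \<in> convex_subbodies \<Omega> c"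
  have "limsup (\<lambda>k. ereal (J_fun \<Omega> (p k) \<omega>)) \<le> ereal (J_inf \<Omega> \<omega>)"
    unfolding Limsup_le_iff
  proof (intro allI impI)
    fix y assume y: "ereal (J_inf \<Omega> \<omega>) < y"
    show "\<forall>\<^sub>F k in sequentially. ereal (J_fun \<Omega> (p k) \<omega>) < y"
    proof (cases y)
      case (real a)
      then have "\<forall>\<^sub>F q in at_top. J_fun \<Omega> q \<omega> < a"
        using J_fun_eventually_less[OF \<open>compact \<Omega>\<close> \<omega>] y by simp
      then show ?thesis
        using p real by (auto dest: eventually_compose_filterlim)
    qed (use y in auto)
  qed
  moreover have "hausdorff_dist \<omega> \<omega> = 0"
    using convex_subbodiesD[OF \<omega>] by (simp add: hausdorff_dist_self compact_imp_bounded)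
  ultimately show "\<exists>u. (\<forall>k. u k \<in> convex_subbodies \<Omega> c) \<and>
      (\<lambda>k. hausdorff_dist (u k) \<omega>) \<longlonglongrightarrow> 0 \<and>
      limsup (\<lambda>k. ereal (J_fun \<Omega> (p k) (u k))) \<le> ereal (J_inf \<Omega> \<omega>)"
    using \<omega> by (intro exI[of _ "\<lambda>_. \<omega>"]) simp
qed

section \<open>Infima and minimisers\<close>

lemma inf_value_le:
  assumes "\<And>y. y \<in> X \<Longrightarrow> 0 \<le> F y" "x \<in> X"
  shows "inf_value X F \<le> F x"
  unfolding inf_value_def using assms by (intro cINF_lower bdd_belowI[of _ 0]) auto

lemma inf_value_lessD:
  assumes "X \<noteq> {}" "inf_value X F < a"
  obtains x where "x \<in> X" "F x < a"
  using assms cInf_lessD[of "F ` X" a] by (auto simp: inf_value_def)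

lemma solves_minI:
  assumes "x \<in> X" "\<And>y. y \<in> X \<Longrightarrow> F x \<le> F y"
  shows "solves_min X F x"
  unfolding solves_min_def inf_value_def using assms
  by (metis (mono_tags, lifting) cInf_eq_minimum imageE imageI)

text \<open>The direct method: a subsequence of a minimising sequence converges within the class,
  and continuity of \<open>J_fun\<close> identifies its limit as a minimiser.\<close>

lemma solves_min_J_fun_exists:
  fixes \<Omega> :: "'a::euclidean_space set"
  assumes "compact \<Omega>" "convex_subbodies \<Omega> c \<noteq> {}" "0 < p"
  shows "\<exists>\<omega>. solves_min (convex_subbodies \<Omega> c) (J_fun \<Omega> p) \<omega>"
proof -
  let ?K = "convex_subbodies \<Omega> c"
  let ?\<sigma> = "inf_value ?K (J_fun \<Omega> p)"
  have "\<exists>\<omega>. \<omega> \<in> ?K \<and> J_fun \<Omega> p \<omega> < ?\<sigma> + inverse (real (Suc k))" for k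
    using inf_value_lessD[OF assms(2), of "J_fun \<Omega> p" "?\<sigma> + inverse (real (Suc k))"]
    by (auto simp del: of_nat_Suc)
  then obtain u where u: "\<And>k. u k \<in> ?K" "\<And>k. J_fun \<Omega> p (u k) < ?\<sigma> + inverse (real (Suc k))"
    by metis
  obtain r \<omega> where r: "strict_mono (r :: nat \<Rightarrow> nat)" and \<omega>: "\<omega> \<in> ?K"
    and lim: "(\<lambda>k. hausdorff_dist (u (r k)) \<omega>) \<longlonglongrightarrow> 0"
    using convex_subbodies_compact[of \<Omega> u c] \<open>compact \<Omega>\<close> u(1) by blast
  have "(\<lambda>k. J_fun \<Omega> p (u (r k))) \<longlonglongrightarrow> J_fun \<Omega> p \<omega>"
    by (rule J_fun_continuous) (use assms u(1) \<omega> lim in auto)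
  moreover have "(\<lambda>k. ?\<sigma> + inverse (real (Suc (r k)))) \<longlonglongrightarrow> ?\<sigma> + 0"
    using LIMSEQ_subseq_LIMSEQ[OF LIMSEQ_inverse_real_of_nat r]
    by (intro tendsto_add tendsto_const) (simp add: o_def)
  ultimately have "J_fun \<Omega> p \<omega> \<le> ?\<sigma> + 0"
    by (rule LIMSEQ_le) (use u(2) less_imp_le in blast)
  then have "J_fun \<Omega> p \<omega> = ?\<sigma>"
    using inf_value_le[of ?K "J_fun \<Omega> p" \<omega>] \<omega> by (simp add: J_fun_nonneg)
  then show ?thesis
    using \<omega> by (auto simp: solves_min_def)
qed

text \<open>The upper bound tests with one near-minimiser of \<open>J_inf\<close>. If the lower
  bound failed, minimisers for a divergent sequence of exponents would have a convergent subsequence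
  whose limit has \<open>J_inf\<close> above \<open>a\<close>, against
  \<open>J_fun_eventually_greater\<close>.\<close>

lemma tendsto_inf_value_J_fun:
  fixes \<Omega> :: "'a::euclidean_space set"
  assumes "compact \<Omega>" "convex_subbodies \<Omega> c \<noteq> {}"
  shows "((\<lambda>p. inf_value (convex_subbodies \<Omega> c) (J_fun \<Omega> p))
    \<longlongrightarrow> inf_value (convex_subbodies \<Omega> c) (J_inf \<Omega>)) at_top"
proof (rule order_tendstoI)
  let ?K = "convex_subbodies \<Omega> c"
  fix a assume "inf_value ?K (J_inf \<Omega>) < a"
  then obtain \<omega> where \<omega>: "\<omega> \<in> ?K" "J_inf \<Omega> \<omega> < a"
    using inf_value_lessD[OF assms(2)] by blast
  from J_fun_eventually_less[OF \<open>compact \<Omega>\<close> \<omega>]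
  show "\<forall>\<^sub>F p in at_top. inf_value ?K (J_fun \<Omega> p) < a"
    by eventually_elim (use inf_value_le[OF J_fun_nonneg \<omega>(1)] in \<open>rule order.strict_trans1\<close>)
next
  let ?K = "convex_subbodies \<Omega> c"
  fix a assume a: "a < inf_value ?K (J_inf \<Omega>)"
  show "\<forall>\<^sub>F p in at_top. a < inf_value ?K (J_fun \<Omega> p)"
  proof (rule ccontr)
    assume "\<not> ?thesis"
    \<comment> \<open>The bound \<open>real k + 1\<close> makes the exponents both positive and
      divergent.\<close>
    then have "\<exists>p\<ge>real k + 1. inf_value ?K (J_fun \<Omega> p) \<le> a" for k :: nat
      by (auto simp: eventually_at_top_linorder not_less)
    then obtain p where p: "\<And>k::nat. real k + 1 \<le> p k" "\<And>k. inf_value ?K (J_fun \<Omega> (p k)) \<le> a"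
      by metis
    have "0 < p k" for k
      using p(1)[of k] by linarith
    then have "\<exists>\<omega>. solves_min ?K (J_fun \<Omega> (p k)) \<omega>" for k
      by (intro solves_min_J_fun_exists assms)
    then obtain u where u: "\<And>k. solves_min ?K (J_fun \<Omega> (p k)) (u k)"
      by metis
    then have uK: "u k \<in> ?K" and ua: "J_fun \<Omega> (p k) (u k) \<le> a" for k
      using p(2)[of k] by (auto simp: solves_min_def)
    obtain r \<omega> where r: "strict_mono (r :: nat \<Rightarrow> nat)" and \<omega>: "\<omega> \<in> ?K"
      and lim: "(\<lambda>k. hausdorff_dist (u (r k)) \<omega>) \<longlonglongrightarrow> 0"
      using convex_subbodies_compact[of \<Omega> u c] \<open>compact \<Omega>\<close> uK by blast
    have "filterlim p at_top sequentially"
      using filterlim_real_sequentially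
      by (rule filterlim_at_top_mono) (intro always_eventually allI order_trans[OF _ p(1)], simp)
    then have "filterlim (\<lambda>k. p (r k)) at_top sequentially"
      using filterlim_subseq[OF r] by (rule filterlim_compose)
    moreover have "a < J_inf \<Omega> \<omega>"
      using a inf_value_le[of ?K "J_inf \<Omega>" \<omega>] J_inf_nonneg \<open>compact \<Omega>\<close> \<omega> by fastforce
    ultimately have "\<forall>\<^sub>F k in sequentially. a < J_fun \<Omega> (p (r k)) (u (r k))"
      by (intro J_fun_eventually_greater[of \<Omega> "\<lambda>k. u (r k)" c \<omega>]) (use \<open>compact \<Omega>\<close> uK \<omega> lim in auto)
    then show False
      using ua by (simp add: not_less[symmetric])
  qed
qed

text \<open>A better competitor \<tau> would leave room for a number \<open>a\<close> strictly
  between the two values of \<open>J_inf\<close>; for late \<open>k\<close> it would separate \<tau>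
  from \<open>u k\<close> in the wrong order for the minimiser \<open>u k\<close>.\<close>

lemma solves_min_J_inf_limit:
  fixes \<Omega> :: "'a::euclidean_space set" and p :: "nat \<Rightarrow> real"
  assumes "compact \<Omega>" and u: "\<And>k. solves_min (convex_subbodies \<Omega> c) (J_fun \<Omega> (p k)) (u k)"
    and p: "filterlim p at_top sequentially"
    and "\<omega> \<noteq> {}" "compact \<omega>" and lim: "(\<lambda>k. hausdorff_dist (u k) \<omega>) \<longlonglongrightarrow> 0"
  shows "solves_min (convex_subbodies \<Omega> c) (J_inf \<Omega>) \<omega>"
proof -
  let ?K = "convex_subbodies \<Omega> c"
  have uK: "u k \<in> ?K" for k
    using u by (simp add: solves_min_def)
  have \<omega>: "\<omega> \<in> ?K"
    by (rule convex_subbodies_closed[of \<Omega> u]) (use assms uK in auto)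
  have "J_inf \<Omega> \<omega> \<le> J_inf \<Omega> \<tau>" if \<tau>: "\<tau> \<in> ?K" for \<tau>
  proof (rule ccontr)
    assume "\<not> ?thesis"
    then obtain a where a: "J_inf \<Omega> \<tau> < a" "a < J_inf \<Omega> \<omega>"
      using dense not_le by blast
    have "\<forall>\<^sub>F k in sequentially. a < J_fun \<Omega> (p k) (u k)"
      by (rule J_fun_eventually_greater[of \<Omega> u c \<omega>]) (use \<open>compact \<Omega>\<close> uK \<omega> lim p a in auto)
    moreover have "\<forall>\<^sub>F k in sequentially. J_fun \<Omega> (p k) \<tau> < a"
      using J_fun_eventually_less[OF \<open>compact \<Omega>\<close> \<tau> a(1)] p by (rule eventually_compose_filterlim)
    ultimately have "\<forall>\<^sub>F k in sequentially. a < J_fun \<Omega> (p k) (u k) \<and> J_fun \<Omega> (p k) \<tau> < a"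
      by (rule eventually_conj)
    then obtain k where "a < J_fun \<Omega> (p k) (u k)" "J_fun \<Omega> (p k) \<tau> < a"
      using eventually_happens'[OF sequentially_bot] by blast
    moreover have "J_fun \<Omega> (p k) (u k) \<le> J_fun \<Omega> (p k) \<tau>"
      using u[of k] inf_value_le[of ?K "J_fun \<Omega> (p k)" \<tau>] \<tau> by (simp add: solves_min_def J_fun_nonneg)
    ultimately show False
      by linarith
  qed
  with \<omega> show ?thesis
    by (rule solves_minI)
qed

text \<open>The first conjunct justifies the second expression for \<open>J_inf\<close>, as an
  attained maximum over the sphere. In the last one the limit ranges over all non-empty compact
  sets, so that its membership in the class is part of the conclusion.\<close>

theorem theorem1:
  fixes \<Omega> :: "'a::euclidean_space set" and c :: real
  assumes "compact \<Omega>" and "convex \<Omega>" and "interior \<Omega> \<noteq> {}"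
    and "0 \<le> c" and "c \<le> measure lebesgue \<Omega>"
  defines "K \<equiv> convex_subbodies \<Omega> c"
  shows
    "(\<forall>\<omega>\<in>K. (\<exists>\<theta>\<in>sphere 0 1. J_inf \<Omega> \<omega> = \<bar>support_fun \<Omega> \<theta> - support_fun \<omega> \<theta>\<bar>) \<and>
             (\<forall>\<theta>\<in>sphere 0 1. \<bar>support_fun \<Omega> \<theta> - support_fun \<omega> \<theta>\<bar> \<le> J_inf \<Omega> \<omega>)) \<and>
     (\<forall>p\<ge>1. \<exists>\<omega>. solves_min K (J_fun \<Omega> p) \<omega>) \<and>
     Gamma_converges K hausdorff_dist (J_fun \<Omega>) (J_inf \<Omega>) \<and>
     ((\<lambda>p. inf_value K (J_fun \<Omega> p)) \<longlongrightarrow> inf_value K (J_inf \<Omega>)) at_top \<and>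
     (\<forall>p u \<omega>. (\<forall>k::nat. 1 \<le> p k \<and> solves_min K (J_fun \<Omega> (p k)) (u k)) \<and>
        filterlim p at_top sequentially \<and>
        \<omega> \<noteq> {} \<and> compact \<omega> \<and> (\<lambda>k. hausdorff_dist (u k) \<omega>) \<longlonglongrightarrow> 0 \<longrightarrow>
        solves_min K (J_inf \<Omega>) \<omega>)"
proof -
  have ne: "convex_subbodies \<Omega> c \<noteq> {}"
    using assms by (intro convex_subbodies_nonempty)
  have "\<exists>\<theta>\<in>sphere 0 1. J_inf \<Omega> \<omega> = \<bar>support_fun \<Omega> \<theta> - support_fun \<omega> \<theta>\<bar>" if "\<omega> \<in> K" for \<omega>
    using hausdorff_dist_eq_support_fun_diff[of \<omega> \<Omega>] convex_subbodiesD[OF that[unfolded K_def]]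
      \<open>compact \<Omega>\<close> by (metis J_inf_def dist_0_norm mem_sphere)
  moreover have "\<bar>support_fun \<Omega> \<theta> - support_fun \<omega> \<theta>\<bar> \<le> J_inf \<Omega> \<omega>"
    if "\<omega> \<in> K" "\<theta> \<in> sphere 0 1" for \<omega> \<theta>
    using abs_support_fun_diff_le_J_inf[of \<Omega> \<omega> c \<theta>] \<open>compact \<Omega>\<close> that by (simp add: K_def)
  moreover have "\<exists>\<omega>. solves_min K (J_fun \<Omega> p) \<omega>" if "1 \<le> p" for p
    unfolding K_def using \<open>compact \<Omega>\<close> ne by (rule solves_min_J_fun_exists) (use that in simp)
  ultimately show ?thesis
    using Gamma_converges_J[OF \<open>compact \<Omega>\<close>] tendsto_inf_value_J_fun[OF \<open>compact \<Omega>\<close> ne]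
      solves_min_J_inf_limit[OF \<open>compact \<Omega>\<close>]
    unfolding K_def by blast
qed

end
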